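(* Consider the network model, interest-based mobility model and FirstMeeting (FM) routing described in the context, but with the destination's profile random: the angle $\angle(S,D)$ is chosen uniformly at random in $[0,\pi/2]$. Let $T^{ib}_{FM}$ be the time at which the message is first delivered to $D$. Then $\mathbb{E}[T^{ib}_{FM}]=O(1)$ as $n\to\infty$.
   Context: Network: fix an integer $m\ge 2$ independent of $n$. There are $n+2$ nodes: a source $S$, a destination $D$ and relays $R_1,\dots,R_n$. Each node $X$ has an interest profile, a unit vector in the closed positive orthant of the unit sphere of $\mathbb{R}^m$; $\cos\angle(X,Y)=\langle X,Y\rangle$. $S=(1,0,\dots,0)$. The relay profiles (and here also $D$'s profile) are independent: the angle with $S$ is uniform on $[0,\pi/2]$, and given this angle the profile is uniform among unit vectors of the positive orthant making that angle with $S$. Profiles are fixed in time. Conditional on the profiles, for each unordered pair $\{A,B\}$ the meeting instants form a Poisson process of rate $\lambda_{AB}$, independently over pairs, from time $0$. Interest-based mobility: $\lambda_{AB}=k\cos\angle(A,B)+\delta$, with $\lambda>0$ fixed, $\delta=\delta(n)>0$, $\delta(n)\to0$, $k=\frac{\pi}{2}(\lambda-\delta)$. FM routing: $S$ holds two copies and always keeps one. If the first node met by $S$ among $\{D,R_1,\dots,R_n\}$ is $D$, the message is delivered then; otherwise the second copy is given to that first relay $R_j$, no further copies are created or transferred, and the message is delivered when the first of $S,R_j$ meets $D$. Expectations are over all profiles and meeting processes. *)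

theory Defs
  imports "HOL-Probability.Probability"
begin

datatype node = Src | Dst | Rel nat

text \<open>Interest profiles live in R^m, represented as real x (real^'d), m = 1 + CARD('d) \<ge> 2.
  The first coordinate is the direction of S.\<close>
type_synonym 'd profile = "real \<times> (real ^ 'd)"

definition src_profile :: "'d::finite profile" where
  "src_profile = (1, 0)"

text \<open>Uniform distribution on the positive orthant of the unit sphere of real^'d
  (normalised surface measure = cone measure: radial projection of the uniform
  distribution on the positive part of the unit ball).\<close>
definition pos_ball :: "(real ^ 'd::finite) set" where
  "pos_ball = {x. (\<forall>i. 0 \<le> x $ i) \<and> norm x \<le> 1}"

definition orthant_sphere_unif :: "(real ^ 'd::finite) measure" where
  "orthant_sphere_unif = distr (uniform_measure lborel pos_ball) borel (\<lambda>x. x /\<^sub>R norm x)"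

text \<open>Profile distribution: angle \<theta> with S uniform on [0,pi/2]; given \<theta>, uniform among
  the unit vectors of the positive orthant making angle \<theta> with S, i.e. (cos \<theta>, sin \<theta> u)
  with u uniform on the positive orthant of the unit sphere of real^'d.\<close>
definition profile_dist :: "'d::finite profile measure" where
  "profile_dist = distr (uniform_measure lborel {0..pi/2} \<Otimes>\<^sub>M orthant_sphere_unif) borel
      (\<lambda>(\<theta>, u). (cos \<theta>, sin \<theta> *\<^sub>R u))"

text \<open>Unit-rate Poisson process given by its i.i.d. Exp(1) inter-arrival times.\<close>
definition unit_poisson :: "(nat \<Rightarrow> real) measure" where
  "unit_poisson = PiM UNIV (\<lambda>_. density lborel (\<lambda>x. ennreal (exponential_density 1 x)))"

definition nodes_with_profile :: "nat \<Rightarrow> node set" where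
  "nodes_with_profile n = insert Dst (Rel ` {1..n})"

definition all_nodes :: "nat \<Rightarrow> node set" where
  "all_nodes n = insert Src (nodes_with_profile n)"

definition node_pairs :: "nat \<Rightarrow> node set set" where
  "node_pairs n = {{A, B} | A B. A \<in> all_nodes n \<and> B \<in> all_nodes n \<and> A \<noteq> B}"

definition net_space :: "nat \<Rightarrow> ((node \<Rightarrow> 'd::finite profile) \<times> (node set \<Rightarrow> nat \<Rightarrow> real)) measure" where
  "net_space n = PiM (nodes_with_profile n) (\<lambda>_. profile_dist) \<Otimes>\<^sub>M PiM (node_pairs n) (\<lambda>_. unit_poisson)"

definition prof :: "(node \<Rightarrow> 'd::finite profile) \<Rightarrow> node \<Rightarrow> 'd profile" where
  "prof p X = (if X = Src then src_profile else p X)"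

text \<open>Interest-based meeting rate lambda_AB = k cos(A,B) + delta (profiles are unit vectors).\<close>
definition meet_rate :: "real \<Rightarrow> real \<Rightarrow> (node \<Rightarrow> 'd::finite profile) \<Rightarrow> node \<Rightarrow> node \<Rightarrow> real" where
  "meet_rate k \<delta> p A B = k * (prof p A \<bullet> prof p B) + \<delta>"

text \<open>i-th meeting instant (i = 0,1,...) of the pair {A,B}: the rate-lambda_AB Poisson process
  obtained by time-scaling the unit-rate process of that pair by 1/lambda_AB.\<close>
definition meet_time :: "real \<Rightarrow> real \<Rightarrow> (node \<Rightarrow> 'd::finite profile) \<times> (node set \<Rightarrow> nat \<Rightarrow> real)
    \<Rightarrow> node \<Rightarrow> node \<Rightarrow> nat \<Rightarrow> real" where
  "meet_time k \<delta> \<omega> A B i = (\<Sum>j\<le>i. snd \<omega> {A, B} j) / meet_rate k \<delta> (fst \<omega>) A B"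

definition next_meet :: "real \<Rightarrow> real \<Rightarrow> (node \<Rightarrow> 'd::finite profile) \<times> (node set \<Rightarrow> nat \<Rightarrow> real)
    \<Rightarrow> node \<Rightarrow> node \<Rightarrow> real \<Rightarrow> real" where
  "next_meet k \<delta> \<omega> A B t = Inf {meet_time k \<delta> \<omega> A B i | i. meet_time k \<delta> \<omega> A B i > t}"

definition fm_delivery_time :: "nat \<Rightarrow> real \<Rightarrow> real \<Rightarrow> (node \<Rightarrow> 'd::finite profile) \<times> (node set \<Rightarrow> nat \<Rightarrow> real)
    \<Rightarrow> real" where
  "fm_delivery_time n k \<delta> \<omega> =
     (let F = (\<lambda>X. meet_time k \<delta> \<omega> Src X 0) in
      if (\<forall>j\<in>{1..n}. F Dst < F (Rel j)) then F Dst
      else (let \<tau> = Min (F ` nodes_with_profile n);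
                j = (LEAST j. j \<in> {1..n} \<and> F (Rel j) = \<tau>)
            in min (next_meet k \<delta> \<omega> Src Dst \<tau>) (next_meet k \<delta> \<omega> (Rel j) Dst \<tau>)))"

end

theory Submission
  imports Defs "HOL-Real_Asymp.Real_Asymp"
begin

text \<open>
  Let F X be the first meeting time of S with X, and let the first relay met by S be j, at time t.
  The delivery time is at most t plus the smaller of the residual waiting times at t of the
  pairs (S, D) and (j, D), which are exponential given everything else.  Everything rests on
  min (x / a) (y / b) \<le> (x + y) / sqrt (a b), which turns the rates into factors depending on a
  single profile each.  It bounds t by (e1 + e2) / (k sqrt (cos(S, R1) cos(S, R2))), with e1, e2
  unit exponentials, and the residual time by a product of 1 / k, a function of D's profile
  and a function of j's profile; both functions have finite mean because inverse square roots are
  integrable, although the mean of 1 / cos(S, D) is infinite.  The sum over j costs only a bounded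
  factor: since every rate is at most k + \<delta>, the event that j is met first is contained in one
  that does not depend on j's profile, and has probability O(1/n), because
  E exp(-z cos \<theta>) \<le> 1 - 2/\<pi> (1 - exp(-z)) makes the resulting integral explicit.
\<close>

section \<open>Unit-rate Poisson process\<close>

text \<open>The delicate configuration is D almost orthogonal to S. Then the rate of (S, D) is
  small, and so is the share of the rate of (j, D) that comes from the first coordinates; bounding
  the latter rate through that share would bring back the non-integrable 1 / cos(S, D). The
  components orthogonal to S are used instead, where D's profile has norm sin(S, D). Cosine and sine
  vanish at opposite ends of [0, pi/2], so D contributes only 1 / sqrt (cos sin), which is
  integrable. Since \<delta> tends to 0, no bound uniform in n can rest on it.

  Independence is exploited without conditional expectations: one coordinate of a product measure is
  redrawn while all others stay frozen. This works because the enlarged event that j is met first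
  and the time t read only clocks of pairs (S, relay), while each residual time reads a clock of a
  pair containing D. The information that D was not met before t is discarded, as it would bias the
  clock of (S, D).\<close>

definition exp1 :: "real measure" where
  "exp1 = density lborel (\<lambda>x. ennreal (exponential_density 1 x))"

lemma sets_exp1 [measurable_cong, simp]: "sets exp1 = sets borel"
  by (simp add: exp1_def)

lemma space_exp1 [simp]: "space exp1 = UNIV"
  by (simp add: exp1_def)

lemma measurable_exp1 [simp]: "measurable exp1 M = measurable borel M"
  by (rule measurable_cong_sets) simp_all

lemma prob_space_exp1: "prob_space exp1"
  unfolding exp1_def by (rule prob_space_exponential_density) simp

lemma unit_poisson_eq: "unit_poisson = PiM UNIV (\<lambda>_. exp1)"
  by (simp add: unit_poisson_def exp1_def)

lemma prob_space_unit_poisson: "prob_space unit_poisson"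
  unfolding unit_poisson_eq by (intro prob_space_PiM prob_space_exp1)

lemma nn_integral_exp1:
  assumes [measurable]: "f \<in> borel_measurable borel"
  shows "(\<integral>\<^sup>+x. f x \<partial>exp1) = (\<integral>\<^sup>+x. ennreal (exp (- x)) * f x * indicator {0..} x \<partial>lborel)"
  unfolding exp1_def
  by (subst nn_integral_density)
     (auto intro!: nn_integral_cong simp: exponential_density_def split: split_indicator)

lemma AE_exp1_nonneg: "AE x in exp1. 0 \<le> x"
  unfolding exp1_def by (subst AE_density) (auto simp: exponential_density_def)

text \<open>For negative \<open>s\<close> the right-hand side exceeds 1, so the bound holds for
  every real threshold and can be applied to sampled values whose sign is known only almost
  surely.\<close>

lemma exp1_atLeast_le: "(\<integral>\<^sup>+x. (if s \<le> x then 1 else 0) \<partial>exp1) \<le> ennreal (exp (- s))"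
proof (cases "0 \<le> s")
  case True
  have "(\<integral>\<^sup>+x. (if s \<le> x then 1 else 0) \<partial>exp1)
      = (\<integral>\<^sup>+x. ennreal (exp (- x)) * indicator {s..} x \<partial>lborel)"
    using True by (subst nn_integral_exp1) (auto intro!: nn_integral_cong split: split_indicator)
  also have "\<dots> = ennreal (0 - (- exp (- s)))"
    by (rule nn_integral_FTC_atLeast) (auto intro!: derivative_eq_intros, real_asymp)
  finally show ?thesis by simp
next
  case False
  interpret prob_space exp1 by (rule prob_space_exp1)
  have "(\<integral>\<^sup>+x. (if s \<le> x then 1 else 0) \<partial>exp1) \<le> (\<integral>\<^sup>+x. 1 \<partial>exp1)"
    by (intro nn_integral_mono) auto
  also have "\<dots> = ennreal 1" by (simp add: emeasure_space_1[simplified])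
  also have "\<dots> \<le> ennreal (exp (- s))" using False by (intro ennreal_leI) auto
  finally show ?thesis .
qed

lemma nn_integral_exp1_excess:
  assumes "0 \<le> t"
  shows "(\<integral>\<^sup>+x. (if t < x then ennreal (x - t) else 0) \<partial>exp1) = ennreal (exp (- t))"
proof -
  have "(\<integral>\<^sup>+x. (if t < x then ennreal (x - t) else 0) \<partial>exp1)
      = (\<integral>\<^sup>+x. ennreal ((x - t) * exp (- x)) * indicator {t..} x \<partial>lborel)"
    using assms
    by (subst nn_integral_exp1)
       (auto intro!: nn_integral_cong simp: ennreal_mult mult.commute split: split_indicator)
  also have "\<dots> = ennreal (0 - (- (t - t + 1) * exp (- t)))"
    by (rule nn_integral_FTC_atLeast[where F = "\<lambda>x. - (x - t + 1) * exp (- x)"])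
       (auto intro!: derivative_eq_intros simp: algebra_simps, real_asymp)
  finally show ?thesis by simp
qed

lemma nn_integral_exp1_ident: "(\<integral>\<^sup>+x. ennreal x \<partial>exp1) = 1"
proof -
  have "(\<integral>\<^sup>+x. ennreal x \<partial>exp1) = (\<integral>\<^sup>+x. (if 0 < x then ennreal (x - 0) else 0) \<partial>exp1)"
    by (intro nn_integral_cong) (auto simp: ennreal_neg)
  also have "\<dots> = 1" by (subst nn_integral_exp1_excess) auto
  finally show ?thesis .
qed

text \<open>Prepending an independent exponential to an i.i.d. sequence gives the same law. This is
  the renewal decomposition at the first arrival, and it drives both inductions on the number of
  arrivals below.\<close>

lemma nn_integral_unit_poisson_Suc:
  assumes [measurable]: "f \<in> borel_measurable unit_poisson"
  shows "(\<integral>\<^sup>+x. f x \<partial>unit_poisson) = (\<integral>\<^sup>+s. \<integral>\<^sup>+x. f (case_nat s x) \<partial>unit_poisson \<partial>exp1)"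
proof -
  interpret E: prob_space exp1 by (rule prob_space_exp1)
  interpret U: prob_space unit_poisson by (rule prob_space_unit_poisson)
  interpret S: sequence_space exp1 ..
  have [measurable]: "f \<in> borel_measurable (PiM UNIV (\<lambda>_. exp1))"
    using assms by (simp add: unit_poisson_eq)
  have "(\<integral>\<^sup>+x. f x \<partial>PiM UNIV (\<lambda>_. exp1))
      = (\<integral>\<^sup>+x. f x \<partial>distr (exp1 \<Otimes>\<^sub>M PiM UNIV (\<lambda>_. exp1)) (PiM UNIV (\<lambda>_. exp1)) (\<lambda>(s, \<omega>). case_nat s \<omega>))"
    by (subst S.PiM_iter) simp
  also have "\<dots> = (\<integral>\<^sup>+z. f (case z of (s, \<omega>) \<Rightarrow> case_nat s \<omega>) \<partial>(exp1 \<Otimes>\<^sub>M PiM UNIV (\<lambda>_. exp1)))"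
    by (subst nn_integral_distr) auto
  also have "\<dots> = (\<integral>\<^sup>+s. \<integral>\<^sup>+x. f (case_nat s x) \<partial>PiM UNIV (\<lambda>_. exp1) \<partial>exp1)"
    using U.sigma_finite_measure_axioms
    by (subst sigma_finite_measure.nn_integral_fst[symmetric]) (auto simp: unit_poisson_eq)
  finally show ?thesis by (simp add: unit_poisson_eq)
qed

lemma nn_integral_unit_poisson_0:
  assumes [measurable]: "f \<in> borel_measurable borel"
  shows "(\<integral>\<^sup>+x. f (x 0) \<partial>unit_poisson) = (\<integral>\<^sup>+s. f s \<partial>exp1)"
proof -
  interpret U: prob_space unit_poisson by (rule prob_space_unit_poisson)
  have "(\<integral>\<^sup>+x. f (x 0) \<partial>unit_poisson) = (\<integral>\<^sup>+s. \<integral>\<^sup>+x. f s \<partial>unit_poisson \<partial>exp1)"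
    by (subst nn_integral_unit_poisson_Suc) (auto simp: unit_poisson_eq)
  then show ?thesis by (simp add: U.emeasure_space_1)
qed

section \<open>Residual waiting time and memorylessness\<close>

definition arrival :: "(nat \<Rightarrow> real) \<Rightarrow> nat \<Rightarrow> real" where
  "arrival x i = (\<Sum>j\<le>i. x j)"

text \<open>Nonzero only if \<open>i\<close> is the least index whose arrival lies beyond
  \<open>t\<close>. Hence the series \<open>residual\<close> has at most one nonzero term, the time
  from \<open>t\<close> to that arrival. The series form gives measurability at once and can be
  exchanged with the integral.\<close>

definition overshoot :: "real \<Rightarrow> (nat \<Rightarrow> real) \<Rightarrow> nat \<Rightarrow> ennreal" where
  "overshoot t x i = (if t < arrival x i \<and> (\<forall>l<i. arrival x l \<le> t) then ennreal (arrival x i - t) else 0)"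

definition residual :: "real \<Rightarrow> (nat \<Rightarrow> real) \<Rightarrow> ennreal" where
  "residual t x = (\<Sum>i. overshoot t x i)"

lemma measurable_component_unit_poisson [measurable]:
  "(\<lambda>x. x i) \<in> borel_measurable unit_poisson"
  unfolding unit_poisson_eq by measurable

lemma measurable_arrival [measurable (raw)]:
  assumes "f \<in> N \<rightarrow>\<^sub>M unit_poisson"
  shows "(\<lambda>z. arrival (f z) i) \<in> borel_measurable N"
proof -
  have "(\<lambda>z. f z j) \<in> borel_measurable N" for j
    using measurable_compose[OF assms measurable_component_unit_poisson] .
  then show ?thesis unfolding arrival_def by measurable
qed

lemma measurable_overshoot [measurable (raw)]:
  assumes [measurable]: "f \<in> N \<rightarrow>\<^sub>M unit_poisson" "g \<in> borel_measurable N"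
  shows "(\<lambda>z. overshoot (g z) (f z) i) \<in> borel_measurable N"
  unfolding overshoot_def by measurable

lemma measurable_residual [measurable (raw)]:
  assumes [measurable]: "f \<in> N \<rightarrow>\<^sub>M unit_poisson" "g \<in> borel_measurable N"
  shows "(\<lambda>z. residual (g z) (f z)) \<in> borel_measurable N"
  unfolding residual_def by measurable

lemma arrival_case_nat:
  "arrival (case_nat s x) 0 = s" "arrival (case_nat s x) (Suc i) = s + arrival x i"
  by (simp_all add: arrival_def sum.atMost_Suc_shift del: sum.atMost_Suc)

lemma overshoot_case_nat:
  "overshoot t (case_nat s x) 0 = (if t < s then ennreal (s - t) else 0)"
  "overshoot t (case_nat s x) (Suc i) = (if s \<le> t then overshoot (t - s) x i else 0)"
  by (auto simp: overshoot_def arrival_case_nat All_less_Suc2 algebra_simps)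

lemma exp1_atLeastAtMost:
  assumes "0 \<le> t"
  shows "(\<integral>\<^sup>+x. (if x \<le> t then 1 else 0) \<partial>exp1) = ennreal (1 - exp (- t))"
proof -
  have "(\<integral>\<^sup>+x. (if x \<le> t then 1 else 0) \<partial>exp1)
      = (\<integral>\<^sup>+x. ennreal (exp (- x)) * indicator {0..t} x \<partial>lborel)"
    by (subst nn_integral_exp1) (auto intro!: nn_integral_cong split: split_indicator)
  also have "\<dots> = ennreal (- exp (- t) - (- exp (- 0)))"
    using assms by (intro nn_integral_FTC_Icc) (auto intro!: derivative_eq_intros)
  finally show ?thesis by simp
qed

text \<open>Memorylessness by induction on the truncation \<open>N\<close>, with \<open>t\<close>
  varying. If the first gap \<open>s\<close> exceeds \<open>t\<close>, the overshoot is
  \<open>s - t\<close>, of expected value exp(-t); otherwise, with probability 1 - exp(-t), the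
  process restarts with threshold \<open>t - s\<close> and the induction hypothesis bounds the rest
  by 1. The two contributions add up to exactly 1.\<close>

lemma nn_integral_sum_overshoot_le:
  "0 \<le> t \<Longrightarrow> (\<integral>\<^sup>+x. (\<Sum>i<N. overshoot t x i) \<partial>unit_poisson) \<le> 1"
proof (induction N arbitrary: t)
  case (Suc N)
  interpret U: prob_space unit_poisson by (rule prob_space_unit_poisson)
  have "(\<integral>\<^sup>+x. (\<Sum>i<Suc N. overshoot t x i) \<partial>unit_poisson)
     = (\<integral>\<^sup>+s. \<integral>\<^sup>+x. (\<Sum>i<Suc N. overshoot t (case_nat s x) i) \<partial>unit_poisson \<partial>exp1)"
    by (subst nn_integral_unit_poisson_Suc) auto
  also have "\<dots> \<le> (\<integral>\<^sup>+s. (if t < s then ennreal (s - t) else 0) + (if s \<le> t then 1 else 0) \<partial>exp1)"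
  proof (intro nn_integral_mono)
    fix s
    have "(\<integral>\<^sup>+x. (\<Sum>i<Suc N. overshoot t (case_nat s x) i) \<partial>unit_poisson)
       = (\<integral>\<^sup>+x. (if t < s then ennreal (s - t) else 0) +
              (if s \<le> t then (\<Sum>i<N. overshoot (t - s) x i) else 0) \<partial>unit_poisson)"
      by (intro nn_integral_cong)
         (simp add: sum.lessThan_Suc_shift overshoot_case_nat del: sum.lessThan_Suc)
    also have "\<dots> \<le> (if t < s then ennreal (s - t) else 0) + (if s \<le> t then 1 else 0)"
      using Suc.IH[of "t - s"] by (auto simp: U.emeasure_space_1)
    finally show "(\<integral>\<^sup>+x. (\<Sum>i<Suc N. overshoot t (case_nat s x) i) \<partial>unit_poisson)
      \<le> (if t < s then ennreal (s - t) else 0) + (if s \<le> t then 1 else 0)" .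
  qed
  also have "\<dots> = ennreal (exp (- t)) + ennreal (1 - exp (- t))"
    using Suc.prems
    by (subst nn_integral_add) (simp_all add: nn_integral_exp1_excess exp1_atLeastAtMost)
  also have "\<dots> = 1" using Suc.prems by (subst ennreal_plus[symmetric]) auto
  finally show ?case .
qed auto

lemma nn_integral_residual_le:
  assumes "0 \<le> t"
  shows "(\<integral>\<^sup>+x. residual t x \<partial>unit_poisson) \<le> 1"
proof -
  have "(\<integral>\<^sup>+x. residual t x \<partial>unit_poisson) = (\<Sum>i. \<integral>\<^sup>+x. overshoot t x i \<partial>unit_poisson)"
    unfolding residual_def by (rule nn_integral_suminf) measurable
  also have "\<dots> = (SUP N. \<Sum>i<N. \<integral>\<^sup>+x. overshoot t x i \<partial>unit_poisson)"
    by (rule suminf_eq_SUP)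
  also have "\<dots> = (SUP N. \<integral>\<^sup>+x. (\<Sum>i<N. overshoot t x i) \<partial>unit_poisson)"
    by (subst nn_integral_sum) auto
  also have "\<dots> \<le> 1"
    using nn_integral_sum_overshoot_le[OF assms] by (intro SUP_least)
  finally show ?thesis .
qed

text \<open>Exponential Markov bound: a unit exponential X has E exp(-X) = 1/2, so the event that
  the sum of \<open>N\<close> gaps is at most \<open>t\<close> has probability at most exp(t) / 2^N.
  The induction peels off one gap and one factor 1/2 at a time.\<close>

lemma nn_integral_no_arrival_after_le:
  "0 \<le> t \<Longrightarrow> (\<integral>\<^sup>+x. (if \<forall>i<N. arrival x i \<le> t then 1 else 0) \<partial>unit_poisson)
     \<le> ennreal (exp t * (1 / 2) ^ N)"
proof (induction N arbitrary: t)
  case 0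
  interpret U: prob_space unit_poisson by (rule prob_space_unit_poisson)
  have "ennreal 1 \<le> ennreal (exp t)" using 0 by (intro ennreal_leI) simp
  then show ?case by (simp add: U.emeasure_space_1)
next
  case (Suc N)
  have "(\<integral>\<^sup>+x. (if \<forall>i<Suc N. arrival x i \<le> t then 1 else 0) \<partial>unit_poisson) =
     (\<integral>\<^sup>+s. \<integral>\<^sup>+x. (if s \<le> t then if \<forall>i<N. arrival x i \<le> t - s then 1 else 0 else 0)
        \<partial>unit_poisson \<partial>exp1)"
    by (subst nn_integral_unit_poisson_Suc)
       (auto intro!: nn_integral_cong simp: arrival_case_nat All_less_Suc2 algebra_simps)
  also have "\<dots> \<le> (\<integral>\<^sup>+s. ennreal (exp (t - s) * (1 / 2) ^ N) \<partial>exp1)"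
  proof (intro nn_integral_mono)
    fix s
    show "(\<integral>\<^sup>+x. (if s \<le> t then if \<forall>i<N. arrival x i \<le> t - s then 1 else 0 else 0) \<partial>unit_poisson)
      \<le> ennreal (exp (t - s) * (1 / 2) ^ N)"
      using Suc.IH[of "t - s"] by (cases "s \<le> t") auto
  qed
  also have "\<dots> = (\<integral>\<^sup>+s. ennreal (exp (t - 2 * s) * (1 / 2) ^ N) * indicator {0..} s \<partial>lborel)"
    by (subst nn_integral_exp1)
       (auto intro!: nn_integral_cong simp flip: ennreal_mult exp_add mult.assoc
             simp: algebra_simps split: split_indicator)
  also have "\<dots> = ennreal (0 - (- exp (t - 2 * 0) * (1 / 2) ^ Suc N))"
    by (rule nn_integral_FTC_atLeast[where F = "\<lambda>s. - exp (t - 2 * s) * (1 / 2) ^ Suc N"])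
       (auto intro!: derivative_eq_intros, real_asymp)
  finally show ?case by simp
qed

text \<open>Guarantees that a meeting exists after every time. Otherwise \<open>next_meet\<close>
  would be the infimum of an empty set of reals and \<open>residual\<close> would be 0. Integer
  thresholds reduce the claim to countably many null sets.\<close>

lemma AE_unit_poisson_unbounded: "AE x in unit_poisson. \<forall>t. \<exists>i. t < arrival x i"
proof -
  have "AE x in unit_poisson. \<exists>i. real m < arrival x i" for m :: nat
  proof -
    let ?A = "\<lambda>x. (if \<forall>i. arrival x i \<le> real m then 1 else 0 :: ennreal)"
    have "(\<integral>\<^sup>+x. ?A x \<partial>unit_poisson) \<le> ennreal (exp (real m) * (1 / 2) ^ N)" for N
      by (rule order_trans[OF nn_integral_mono nn_integral_no_arrival_after_le]) auto
    moreover have "(\<lambda>N. ennreal (exp (real m) * (1 / 2) ^ N)) \<longlonglongrightarrow> ennreal 0"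
      by (intro tendsto_ennrealI) real_asymp
    ultimately have "(\<integral>\<^sup>+x. ?A x \<partial>unit_poisson) \<le> ennreal 0"
      by (intro LIMSEQ_le_const) blast+
    then have "(\<integral>\<^sup>+x. ?A x \<partial>unit_poisson) \<le> 0" by simp
    then have "AE x in unit_poisson. ?A x = 0"
      by (subst (asm) le_zero_eq, subst (asm) nn_integral_0_iff_AE) measurable
    then show ?thesis
    proof eventually_elim
      case (elim x)
      then have "\<not> (\<forall>i. arrival x i \<le> real m)" by (metis zero_neq_one)
      then show ?case by (simp add: not_le)
    qed
  qed
  then have "AE x in unit_poisson. \<forall>m::nat. \<exists>i. real m < arrival x i"
    by (simp add: AE_all_countable)
  then show ?thesis
    by eventually_elim (meson less_trans reals_Archimedean2)
qed

lemma residual_ge: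
  assumes "\<exists>i. t < arrival x i"
  obtains i where "t < arrival x i" "ennreal (arrival x i - t) \<le> residual t x"
proof
  let ?i = "LEAST i. t < arrival x i"
  show "t < arrival x ?i" using assms by (rule LeastI_ex)
  moreover have "\<forall>l < ?i. arrival x l \<le> t" by (auto dest: not_less_Least simp: not_less)
  ultimately have "ennreal (arrival x ?i - t) = overshoot t x ?i"
    by (simp add: overshoot_def)
  also have "\<dots> \<le> residual t x"
    unfolding residual_def using sum_le_suminf[of "overshoot t x" "{?i}"] by simp
  finally show "ennreal (arrival x ?i - t) \<le> residual t x" .
qed

lemma AE_unit_poisson_first_nonneg: "AE x in unit_poisson. 0 \<le> x 0"
proof -
  have "AE x in PiM UNIV (\<lambda>_::nat. exp1). 0 \<le> x 0"
    by (intro AE_PiM_component prob_space_exp1 AE_exp1_nonneg) auto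
  then show ?thesis unfolding unit_poisson_eq .
qed

section \<open>Finite products of probability spaces\<close>

text \<open>Redrawing one coordinate independently preserves the product law. If the other factors
  of an integrand do not read that coordinate, they become constants of the inner integral, while
  the index set \<open>I\<close> stays the same.\<close>

lemma nn_integral_PiM_resample:
  assumes "prob_space M" "finite I" "i \<in> I"
    and [measurable]: "f \<in> borel_measurable (PiM I (\<lambda>_. M))"
  shows "(\<integral>\<^sup>+x. f x \<partial>PiM I (\<lambda>_. M)) = (\<integral>\<^sup>+x. \<integral>\<^sup>+y. f (x(i := y)) \<partial>M \<partial>PiM I (\<lambda>_. M))"
proof -
  interpret M: prob_space M by fact
  interpret P: product_sigma_finite "\<lambda>_. M" ..
  define J where "J = I - {i}"
  have J: "finite J" "i \<notin> J" "I = insert i J" using assms by (auto simp: J_def)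
  have upd [measurable]: "(\<lambda>z. (fst z)(i := snd z)) \<in> PiM I (\<lambda>_. M) \<Otimes>\<^sub>M M \<rightarrow>\<^sub>M PiM I (\<lambda>_. M)"
    using J by (intro measurable_fun_upd[where J = I]) auto
  \<comment> \<open>The original value \<open>z\<close> of coordinate \<open>i\<close> is
    overwritten by \<open>y\<close>, so the integral over \<open>z\<close> only contributes total
    mass 1.\<close>
  have "(\<integral>\<^sup>+x. \<integral>\<^sup>+y. f (x(i := y)) \<partial>M \<partial>PiM I (\<lambda>_. M))
     = (\<integral>\<^sup>+x. \<integral>\<^sup>+z. \<integral>\<^sup>+y. f ((x(i := z))(i := y)) \<partial>M \<partial>M \<partial>PiM J (\<lambda>_. M))"
    unfolding \<open>I = insert i J\<close>
  proof (rule P.product_nn_integral_insert[OF J(1,2)])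
    have "(\<lambda>z. f ((fst z)(i := snd z))) \<in> borel_measurable (PiM I (\<lambda>_. M) \<Otimes>\<^sub>M M)"
      by measurable
    then show "(\<lambda>x. \<integral>\<^sup>+y. f (x(i := y)) \<partial>M) \<in> borel_measurable (PiM (insert i J) (\<lambda>_. M))"
      using J by (intro M.borel_measurable_nn_integral) (simp add: split_beta')
  qed
  also have "\<dots> = (\<integral>\<^sup>+x. \<integral>\<^sup>+y. f (x(i := y)) \<partial>M \<partial>PiM J (\<lambda>_. M))"
    by (simp add: M.emeasure_space_1)
  also have "\<dots> = (\<integral>\<^sup>+x. f x \<partial>PiM I (\<lambda>_. M))"
    unfolding \<open>I = insert i J\<close>
    using assms(4) J by (intro P.product_nn_integral_insert[OF J(1,2), symmetric]) auto
  finally show ?thesis ..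
qed

text \<open>Independence of the coordinates selected by \<open>h\<close>, which will be the identity
  or the map from a relay index to its pair with S. Coordinates outside the image of
  \<open>h\<close> receive the factor 1.\<close>

lemma nn_integral_PiM_prod_inj:
  assumes "prob_space M" "finite I" "inj_on h J" "h ` J \<subseteq> I"
    and f: "\<And>j. j \<in> J \<Longrightarrow> f j \<in> borel_measurable M"
  shows "(\<integral>\<^sup>+x. (\<Prod>j\<in>J. f j (x (h j))) \<partial>PiM I (\<lambda>_. M)) = (\<Prod>j\<in>J. \<integral>\<^sup>+y. f j y \<partial>M)"
proof -
  interpret M: prob_space M by fact
  interpret P: product_sigma_finite "\<lambda>_. M" ..
  define g where "g i = (if i \<in> h ` J then f (the_inv_into J h i) else (\<lambda>_. 1))" for i
  have gh: "g (h j) = f j" if "j \<in> J" for j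
    using that assms(3) by (simp add: g_def the_inv_into_f_f)
  have g_notin: "g i = (\<lambda>_. 1)" if "i \<notin> h ` J" for i
    using that by (simp add: g_def)
  have restrict: "(\<Prod>i\<in>I. F i) = (\<Prod>j\<in>J. F (h j))" if "\<And>i. i \<notin> h ` J \<Longrightarrow> F i = 1" for F :: "_ \<Rightarrow> ennreal"
  proof -
    have "(\<Prod>i\<in>I. F i) = (\<Prod>i\<in>h ` J. F i)"
      using assms that by (intro prod.mono_neutral_right) auto
    then show ?thesis using assms(3) by (simp add: prod.reindex)
  qed
  have "(\<integral>\<^sup>+x. (\<Prod>j\<in>J. f j (x (h j))) \<partial>PiM I (\<lambda>_. M)) = (\<integral>\<^sup>+x. (\<Prod>i\<in>I. g i (x i)) \<partial>PiM I (\<lambda>_. M))"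
    by (intro nn_integral_cong, subst restrict) (simp_all add: g_notin gh cong: prod.cong)
  also have "\<dots> = (\<Prod>i\<in>I. \<integral>\<^sup>+y. g i y \<partial>M)"
    using assms(3) f
    by (intro P.product_nn_integral_prod[OF assms(2)]) (auto simp: g_def the_inv_into_f_f)
  also have "\<dots> = (\<Prod>j\<in>J. \<integral>\<^sup>+y. f j y \<partial>M)"
    by (subst restrict) (simp_all add: g_notin gh M.emeasure_space_1 cong: prod.cong)
  finally show ?thesis .
qed

section \<open>Profile distribution\<close>

text \<open>Jordan's inequality: sine is concave on [0, pi/2], hence lies above its chord.\<close>

lemma sin_ge_linear:
  assumes "0 \<le> x" "x \<le> pi / 2"
  shows "2 / pi * x \<le> sin x"
proof -
  have "convex_on {0..pi/2} (\<lambda>x. - sin x)"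
    by (rule f''_ge0_imp_convex[where f' = "\<lambda>x. - cos x" and f'' = sin])
       (auto intro!: derivative_eq_intros sin_ge_zero)
  from convex_onD[OF this, of "2 / pi * x" 0 "pi / 2"] show ?thesis
    using assms by (simp add: field_simps)
qed

lemma cos_ge_linear:
  assumes "0 \<le> x" "x \<le> pi / 2"
  shows "1 - 2 / pi * x \<le> cos x"
  using sin_ge_linear[of "pi / 2 - x"] assms by (simp add: cos_sin_eq field_simps)

section \<open>Inverse square roots of the sine and cosine of a uniform angle\<close>

definition angle_unif :: "real measure" where
  "angle_unif = uniform_measure lborel {0..pi/2}"

lemma sets_angle_unif [measurable_cong, simp]: "sets angle_unif = sets borel"
  and space_angle_unif [simp]: "space angle_unif = UNIV"
  by (simp_all add: angle_unif_def)

lemma measurable_angle_unif [simp]: "measurable angle_unif M = measurable borel M"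
  by (rule measurable_cong_sets) simp_all

lemma prob_space_angle_unif: "prob_space angle_unif"
  unfolding angle_unif_def by (rule prob_space_uniform_measure) auto

lemma nn_integral_angle_unif_finite:
  assumes [measurable]: "f \<in> borel_measurable borel"
    and "(\<integral>\<^sup>+x. f x * indicator {0..pi/2} x \<partial>lborel) < \<infinity>"
  shows "(\<integral>\<^sup>+x. f x \<partial>angle_unif) < \<infinity>"
  using assms(2) unfolding angle_unif_def
  by (subst nn_integral_uniform_measure) (auto simp: ennreal_divide_eq_top_iff less_top[symmetric])

lemma inverse_sqrt_integral_0_1:
  "(\<integral>\<^sup>+x. ennreal (1 / sqrt x) * indicator {0..1} x \<partial>lborel) = 2"
proof -
  have "((\<lambda>x. 1 / sqrt x) has_integral (2 * sqrt 1 - 2 * sqrt 0)) {0..1}"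
    \<comment> \<open>The antiderivative 2 sqrt x is continuous on [0, 1] but not differentiable at
      0; the interior version asks for the derivative only on the open interval. The two lemmas on
      cosine and sine below rely on the same point.\<close>
    by (rule fundamental_theorem_of_calculus_interior)
       (auto intro!: continuous_intros derivative_eq_intros
         simp: divide_simps simp flip: has_real_derivative_iff_has_vector_derivative)
  from nn_integral_has_integral_lebesgue'[OF _ this] show ?thesis by simp
qed

lemma nn_integral_inverse_sqrt_cos_finite:
  "(\<integral>\<^sup>+x. ennreal (1 / sqrt (cos x)) \<partial>angle_unif) < \<infinity>"
proof (rule nn_integral_angle_unif_finite)
  have "((\<lambda>x. 1 / sqrt (1 - 2 / pi * x)) has_integral
      (- pi * sqrt (1 - 2 / pi * (pi/2)) - (- pi * sqrt (1 - 2 / pi * 0)))) {0..pi/2}"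
    by (rule fundamental_theorem_of_calculus_interior)
       (auto intro!: continuous_intros derivative_eq_intros
         simp: divide_simps simp flip: has_real_derivative_iff_has_vector_derivative)
  from nn_integral_has_integral_lebesgue'[OF _ this]
  have eq: "(\<integral>\<^sup>+x. ennreal (1 / sqrt (1 - 2 / pi * x)) * indicator {0..pi/2} x \<partial>lborel) = ennreal pi"
    by (simp add: field_simps)
  have "(\<integral>\<^sup>+x. ennreal (1 / sqrt (cos x)) * indicator {0..pi/2} x \<partial>lborel)
    \<le> (\<integral>\<^sup>+x. ennreal (1 / sqrt (1 - 2 / pi * x)) * indicator {0..pi/2} x \<partial>lborel)"
  proof (intro nn_integral_mono)
    fix x :: real
    have "1 / sqrt (cos x) \<le> 1 / sqrt (1 - 2 / pi * x)" if x: "0 \<le> x" "x \<le> pi/2"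
    proof (cases "x = pi/2")
      case False
      with x have "0 < 1 - 2 / pi * x" by (simp add: field_simps)
      moreover from this have "0 < cos x" using cos_ge_linear[OF x] by linarith
      ultimately show ?thesis using cos_ge_linear[OF x]
        by (intro divide_left_mono mult_pos_pos) simp_all
    next
      \<comment> \<open>At the right endpoint both radicands vanish, and both quotients are 0 by the
        convention for division by zero.\<close>
      case True
      show ?thesis unfolding True by simp
    qed
    then show "ennreal (1 / sqrt (cos x)) * indicator {0..pi/2} x
      \<le> ennreal (1 / sqrt (1 - 2 / pi * x)) * indicator {0..pi/2} x"
      by (auto intro!: ennreal_leI split: split_indicator)
  qed
  with eq show "(\<integral>\<^sup>+x. ennreal (1 / sqrt (cos x)) * indicator {0..pi/2} x \<partial>lborel) < \<infinity>"
    by (simp add: le_less_trans)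
qed simp

lemma nn_integral_inverse_sqrt_sin_finite:
  "(\<integral>\<^sup>+x. ennreal (1 / sqrt (sin x)) \<partial>angle_unif) < \<infinity>"
proof (rule nn_integral_angle_unif_finite)
  have "((\<lambda>x. 1 / sqrt (2 / pi * x)) has_integral
      (pi * sqrt (2 / pi * (pi/2)) - pi * sqrt (2 / pi * 0))) {0..pi/2}"
    by (rule fundamental_theorem_of_calculus_interior)
       (auto intro!: continuous_intros derivative_eq_intros
         simp: divide_simps simp flip: has_real_derivative_iff_has_vector_derivative)
  from nn_integral_has_integral_lebesgue'[OF _ this]
  have eq: "(\<integral>\<^sup>+x. ennreal (1 / sqrt (2 / pi * x)) * indicator {0..pi/2} x \<partial>lborel) = ennreal pi"
    by simp
  have "(\<integral>\<^sup>+x. ennreal (1 / sqrt (sin x)) * indicator {0..pi/2} x \<partial>lborel)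
    \<le> (\<integral>\<^sup>+x. ennreal (1 / sqrt (2 / pi * x)) * indicator {0..pi/2} x \<partial>lborel)"
  proof (intro nn_integral_mono)
    fix x :: real
    have "1 / sqrt (sin x) \<le> 1 / sqrt (2 / pi * x)" if x: "0 \<le> x" "x \<le> pi/2"
    proof (cases "x = 0")
      case False
      with x have "0 < 2 / pi * x" by (simp add: field_simps)
      moreover from this have "0 < sin x" using sin_ge_linear[OF x] by linarith
      ultimately show ?thesis using sin_ge_linear[OF x]
        by (intro divide_left_mono mult_pos_pos) simp_all
    qed simp
    then show "ennreal (1 / sqrt (sin x)) * indicator {0..pi/2} x
      \<le> ennreal (1 / sqrt (2 / pi * x)) * indicator {0..pi/2} x"
      by (auto intro!: ennreal_leI split: split_indicator)
  qed
  with eq show "(\<integral>\<^sup>+x. ennreal (1 / sqrt (sin x)) * indicator {0..pi/2} x \<partial>lborel) < \<infinity>"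
    by (simp add: le_less_trans)
qed simp

lemma AE_angle_unif: "AE x in angle_unif. 0 < x \<and> x < pi / 2"
  unfolding angle_unif_def
proof (rule AE_uniform_measureI)
  show "AE x in lborel. x \<in> {0..pi/2} \<longrightarrow> 0 < x \<and> x < pi / 2"
    using AE_lborel_singleton[of 0] AE_lborel_singleton[of "pi/2"]
    by eventually_elim auto
qed simp

section \<open>Uniform distribution on the positive orthant of the sphere\<close>

lemma pos_ball_measurable [measurable, simp]: "pos_ball \<in> sets borel"
  unfolding pos_ball_def by measurable

lemma pos_ball_subset_cbox: "(pos_ball :: (real ^ 'd::finite) set) \<subseteq> cbox 0 1"
proof
  fix x :: "real ^ 'd" assume "x \<in> pos_ball"
  then have "0 \<le> x $ i" "x $ i \<le> 1" for i
    using component_le_norm_cart[of x i] by (auto simp: pos_ball_def abs_le_iff)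
  then show "x \<in> cbox 0 1" by (simp add: mem_box_cart)
qed

text \<open>The set lies between two cubes: one of side 1 / d, inside because the Euclidean norm is
  at most the l1 norm, and the unit cube. This makes the normalisation by its volume
  legitimate.\<close>

lemma emeasure_pos_ball:
  "emeasure lborel (pos_ball :: (real ^ 'd::finite) set) \<noteq> 0"
  "emeasure lborel (pos_ball :: (real ^ 'd::finite) set) \<noteq> \<infinity>"
proof -
  let ?c = "(\<chi> i. 1 / real CARD('d)) :: real ^ 'd"
  have "cbox 0 ?c \<subseteq> pos_ball"
  proof
    fix x assume "x \<in> cbox 0 ?c"
    then have x: "0 \<le> x $ i" "x $ i \<le> 1 / real CARD('d)" for i
      by (auto simp: mem_box_cart)
    have "norm x \<le> (\<Sum>i\<in>UNIV. \<bar>x $ i\<bar>)" by (rule norm_le_l1_cart)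
    also have "\<dots> \<le> (\<Sum>i\<in>(UNIV::'d set). 1 / real CARD('d))"
      using x by (intro sum_mono) simp
    finally show "x \<in> pos_ball" using x by (simp add: pos_ball_def)
  qed
  then have "emeasure lborel (cbox 0 ?c) \<le> emeasure lborel (pos_ball :: (real ^ 'd) set)"
    by (intro emeasure_mono) auto
  moreover have "emeasure lborel (cbox 0 ?c) > 0"
    by (subst emeasure_lborel_cbox) (auto simp: Basis_vec_def inner_axis intro!: prod_pos)
  ultimately show "emeasure lborel (pos_ball :: (real ^ 'd) set) \<noteq> 0" by auto
  have "emeasure lborel (pos_ball :: (real ^ 'd) set) \<le> emeasure lborel (cbox 0 (1 :: real ^ 'd))"
    using pos_ball_subset_cbox by (intro emeasure_mono) auto
  also have "\<dots> < \<infinity>" by (rule emeasure_lborel_cbox_finite)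
  finally show "emeasure lborel (pos_ball :: (real ^ 'd) set) \<noteq> \<infinity>" by auto
qed

lemma prob_space_pos_ball: "prob_space (uniform_measure lborel (pos_ball :: (real ^ 'd::finite) set))"
  by (intro prob_space_uniform_measure emeasure_pos_ball)

lemma sets_orthant_sphere_unif [measurable_cong, simp]: "sets orthant_sphere_unif = sets borel"
  and space_orthant_sphere_unif [simp]: "space orthant_sphere_unif = UNIV"
  by (simp_all add: orthant_sphere_unif_def)

lemma measurable_orthant_sphere_unif [simp]: "measurable orthant_sphere_unif M = measurable borel M"
  by (rule measurable_cong_sets) simp_all

lemma prob_space_orthant_sphere_unif: "prob_space (orthant_sphere_unif :: (real ^ 'd::finite) measure)"
  unfolding orthant_sphere_unif_def
  by (intro prob_space.prob_space_distr prob_space_pos_ball) simp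

text \<open>The coordinate hyperplanes are null sets. Strict positivity also excludes the origin,
  where the radial projection does not produce a unit vector.\<close>

lemma AE_pos_ball:
  "AE x in uniform_measure lborel (pos_ball :: (real ^ 'd::finite) set). (\<forall>i. 0 < x $ i) \<and> norm x \<le> 1"
proof (rule AE_uniform_measureI)
  have "AE x in (lborel :: (real ^ 'd) measure). x $ i \<noteq> 0" for i
  proof -
    have "{x :: real ^ 'd. x $ i = 0} \<in> null_sets lborel"
      using negligible_standard_hyperplane_cart[of i]
      by (subst null_sets_completion_iff[symmetric])
         (auto simp: negligible_iff_null_sets intro!: borel_closed closed_Collect_eq continuous_intros)
    from AE_not_in[OF this] show ?thesis by simp
  qed
  then have "AE x in (lborel :: (real ^ 'd) measure). \<forall>i. x $ i \<noteq> 0"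
    by (simp add: AE_all_countable)
  then show "AE x in lborel. x \<in> pos_ball \<longrightarrow> (\<forall>i. 0 < x $ i) \<and> norm (x :: real ^ 'd) \<le> 1"
    by eventually_elim (auto simp: pos_ball_def less_le)
qed simp

lemma AE_orthant_sphere_unif:
  "AE u in (orthant_sphere_unif :: (real ^ 'd::finite) measure). (\<forall>i. 0 < u $ i) \<and> norm u = 1"
  unfolding orthant_sphere_unif_def
proof (subst AE_distr_iff)
  show "AE x in uniform_measure lborel (pos_ball :: (real ^ 'd) set).
      (\<forall>i. 0 < (x /\<^sub>R norm x) $ i) \<and> norm (x /\<^sub>R norm x) = 1"
    using AE_pos_ball
  proof eventually_elim
    case (elim x)
    then have "x \<noteq> 0" by (auto simp: vec_eq_iff less_le)
    with elim show ?case by simp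
  qed
qed measurable

text \<open>Points of the ball have norm at most 1, so radial projection can only enlarge a positive
  coordinate and shrink its inverse square root. This reduces the claim to the uniform distribution
  on the ball, and enlarging the ball to the unit cube turns the integral into a product of
  one-dimensional ones.\<close>

lemma nn_integral_inverse_sqrt_component_finite:
  "(\<integral>\<^sup>+u. ennreal (1 / sqrt (u $ i)) \<partial>(orthant_sphere_unif :: (real ^ 'd::finite) measure)) < \<infinity>"
proof -
  \<comment> \<open>\<open>?g\<close> is the factor along the basis vector \<open>b\<close> of the
    integrand on the unit cube: only the axis \<open>i\<close> carries the singularity.\<close>
  let ?g = "\<lambda>b x. (if b = axis i 1 then ennreal (1 / sqrt x) else 1) * indicator {0..1} x"
  have "(\<integral>\<^sup>+u. ennreal (1 / sqrt (u $ i)) \<partial>(orthant_sphere_unif :: (real ^ 'd::finite) measure))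
     = (\<integral>\<^sup>+x. ennreal (1 / sqrt ((x /\<^sub>R norm x) $ i)) \<partial>uniform_measure lborel (pos_ball :: (real ^ 'd) set))"
    unfolding orthant_sphere_unif_def by (subst nn_integral_distr) simp_all
  also have "\<dots> \<le> (\<integral>\<^sup>+x. ennreal (1 / sqrt (x $ i)) \<partial>uniform_measure lborel (pos_ball :: (real ^ 'd) set))"
  proof (rule nn_integral_mono_AE)
    show "AE x in uniform_measure lborel (pos_ball :: (real ^ 'd) set).
      ennreal (1 / sqrt ((x /\<^sub>R norm x) $ i)) \<le> ennreal (1 / sqrt (x $ i))"
      using AE_pos_ball
    proof eventually_elim
      case (elim x)
      then have "x \<noteq> 0" by (auto simp: vec_eq_iff less_le)
      then have "0 < norm x" by simp
      with elim have "x $ i \<le> (x /\<^sub>R norm x) $ i"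
        by (simp add: field_simps mult_left_le)
      moreover have "0 < x $ i" using elim by simp
      moreover from calculation have "0 < (x /\<^sub>R norm x) $ i" by linarith
      ultimately show ?case
        by (intro ennreal_leI divide_left_mono mult_pos_pos real_sqrt_le_mono real_sqrt_gt_zero) auto
    qed
  qed
  also have "\<dots> = (\<integral>\<^sup>+x. ennreal (1 / sqrt (x $ i)) * indicator pos_ball x \<partial>lborel) / emeasure lborel (pos_ball :: (real ^ 'd) set)"
    by (intro nn_integral_uniform_measure) simp_all
  also have "\<dots> < \<infinity>"
  proof -
    have "(\<integral>\<^sup>+x. ennreal (1 / sqrt (x $ i)) * indicator pos_ball x \<partial>(lborel :: (real ^ 'd) measure))
      \<le> (\<integral>\<^sup>+x. (\<Prod>b\<in>Basis. ?g b (x \<bullet> b)) \<partial>(lborel :: (real ^ 'd) measure))"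
    proof (intro nn_integral_mono)
      fix x :: "real ^ 'd"
      show "ennreal (1 / sqrt (x $ i)) * indicator pos_ball x \<le> (\<Prod>b\<in>Basis. ?g b (x \<bullet> b))"
      proof (cases "x \<in> pos_ball")
        case True
        then have "x \<in> cbox 0 1" using pos_ball_subset_cbox by blast
        then have "\<And>j. x $ j \<in> {0..1}" by (simp add: mem_box_cart)
        then have "(\<Prod>b\<in>Basis. ?g b (x \<bullet> b)) = (\<Prod>b\<in>Basis. if b = axis i 1 then ennreal (1 / sqrt (x \<bullet> b)) else 1)"
          by (intro prod.cong) (auto simp: Basis_vec_def inner_axis)
        also have "\<dots> = ennreal (1 / sqrt (x $ i))"
          by (subst prod.delta) (auto simp: axis_in_Basis_iff inner_axis)
        finally show ?thesis using True by simp
      qed simp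
    qed
    also have "\<dots> = (\<Prod>b\<in>(Basis :: (real ^ 'd) set). \<integral>\<^sup>+x. ?g b x \<partial>lborel)"
      by (intro nn_integral_lborel_prod) auto
    also have "\<dots> < \<infinity>"
    proof -
      have "(\<integral>\<^sup>+x. ?g b x \<partial>lborel) \<noteq> \<infinity>" for b :: "real ^ 'd"
        by (cases "b = axis i 1") (simp_all add: inverse_sqrt_integral_0_1)
      then show ?thesis by (simp add: ennreal_prod_eq_top less_top[symmetric])
    qed
    finally show ?thesis
      using emeasure_pos_ball[where 'd='d] by (auto simp: ennreal_divide_eq_top_iff less_top[symmetric])
  qed
  finally show ?thesis .
qed

section \<open>Profiles: positivity and finite mean of the weights\<close>

lemma sets_profile_dist [measurable_cong, simp]: "sets profile_dist = sets borel"
  and space_profile_dist [simp]: "space profile_dist = UNIV"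
  by (simp_all add: profile_dist_def)

lemma measurable_profile_dist [simp]: "measurable profile_dist M = measurable borel M"
  by (rule measurable_cong_sets) simp_all

lemma profile_map_measurable [measurable]:
  "(\<lambda>(\<theta>, u). (cos \<theta>, sin \<theta> *\<^sub>R u)) \<in> angle_unif \<Otimes>\<^sub>M orthant_sphere_unif \<rightarrow>\<^sub>M (borel :: 'd::finite profile measure)"
proof -
  have "(\<lambda>(\<theta>, u). (cos \<theta>, sin \<theta> *\<^sub>R u)) \<in> borel \<Otimes>\<^sub>M borel \<rightarrow>\<^sub>M (borel \<Otimes>\<^sub>M borel :: 'd profile measure)"
    by measurable
  then show ?thesis by (simp add: borel_prod cong: measurable_cong_sets)
qed

lemma profile_dist_eq:
  "profile_dist = distr (angle_unif \<Otimes>\<^sub>M orthant_sphere_unif) borel (\<lambda>(\<theta>, u). (cos \<theta>, sin \<theta> *\<^sub>R u))"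
  by (simp add: profile_dist_def angle_unif_def)

interpretation angle_unif: prob_space angle_unif
  by (rule prob_space_angle_unif)

interpretation orthant_sphere_unif: prob_space orthant_sphere_unif
  by (rule prob_space_orthant_sphere_unif)

interpretation angle_orthant: pair_prob_space angle_unif orthant_sphere_unif ..

lemma prob_space_profile_dist: "prob_space (profile_dist :: 'd::finite profile measure)"
  unfolding profile_dist_eq by (intro angle_orthant.prob_space_distr) simp

lemma nn_integral_profile_dist:
  fixes f :: "'d::finite profile \<Rightarrow> ennreal"
  assumes [measurable]: "f \<in> borel_measurable borel"
  shows "(\<integral>\<^sup>+p. f p \<partial>profile_dist)
    = (\<integral>\<^sup>+\<theta>. \<integral>\<^sup>+u. f (cos \<theta>, sin \<theta> *\<^sub>R u) \<partial>orthant_sphere_unif \<partial>angle_unif)"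
proof -
  have "(\<integral>\<^sup>+p. f p \<partial>profile_dist)
    = (\<integral>\<^sup>+z. f (case z of (\<theta>, u) \<Rightarrow> (cos \<theta>, sin \<theta> *\<^sub>R u)) \<partial>(angle_unif \<Otimes>\<^sub>M orthant_sphere_unif))"
    unfolding profile_dist_eq by (subst nn_integral_distr) simp_all
  also have "\<dots> = (\<integral>\<^sup>+\<theta>. \<integral>\<^sup>+u. f (cos \<theta>, sin \<theta> *\<^sub>R u) \<partial>orthant_sphere_unif \<partial>angle_unif)"
    by (subst orthant_sphere_unif.nn_integral_fst[symmetric]) auto
  finally show ?thesis .
qed

definition interior_profile :: "'d::finite profile \<Rightarrow> bool" where
  "interior_profile p \<longleftrightarrow> 0 < fst p \<and> fst p \<le> 1 \<and> (\<forall>i. 0 < snd p $ i)"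

lemma measurable_fst_profile [measurable]: "(fst :: 'd::finite profile \<Rightarrow> real) \<in> borel_measurable borel"
  and measurable_snd_profile [measurable]: "(snd :: 'd::finite profile \<Rightarrow> _) \<in> borel_measurable borel"
  and measurable_snd_profile_component [measurable]:
    "(\<lambda>p :: 'd::finite profile. snd p $ i) \<in> borel_measurable borel"
  by (auto intro!: borel_measurable_continuous_onI continuous_intros)

lemma AE_interior_profile: "AE p in (profile_dist :: 'd::finite profile measure). interior_profile p"
proof -
  have [measurable]: "Measurable.pred borel (interior_profile :: 'd profile \<Rightarrow> bool)"
    unfolding interior_profile_def by measurable
  have "AE \<theta> in angle_unif. AE u in (orthant_sphere_unif :: (real ^ 'd) measure). interior_profile (cos \<theta>, sin \<theta> *\<^sub>R u)"
    using AE_angle_unif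
  proof eventually_elim
    case (elim \<theta>)
    then have "0 < sin \<theta>" "0 < cos \<theta>" by (auto intro: sin_gt_zero2 cos_gt_zero)
    from AE_orthant_sphere_unif show ?case
      by eventually_elim (use \<open>0 < sin \<theta>\<close> \<open>0 < cos \<theta>\<close> in \<open>simp add: interior_profile_def\<close>)
  qed
  then have "AE z in angle_unif \<Otimes>\<^sub>M orthant_sphere_unif.
     (interior_profile (case z of (\<theta>, u) \<Rightarrow> (cos \<theta>, sin \<theta> *\<^sub>R u :: real ^ 'd)))"
  proof (intro angle_orthant.AE_pair_measure)
    have "Measurable.pred (angle_unif \<Otimes>\<^sub>M orthant_sphere_unif)
       (\<lambda>z. interior_profile (case z of (\<theta>, u) \<Rightarrow> (cos \<theta>, sin \<theta> *\<^sub>R u :: real ^ 'd)))"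
      by (rule measurable_compose[OF profile_map_measurable]) simp
    then show "{z \<in> space (angle_unif \<Otimes>\<^sub>M orthant_sphere_unif).
       interior_profile (case z of (\<theta>, u) \<Rightarrow> (cos \<theta>, sin \<theta> *\<^sub>R u :: real ^ 'd))}
       \<in> sets (angle_unif \<Otimes>\<^sub>M orthant_sphere_unif)"
      by (simp only: pred_def)
  qed simp
  then show ?thesis unfolding profile_dist_eq
    by (subst AE_distr_iff) auto
qed

lemma nn_integral_inverse_sqrt_fst_finite:
  "(\<integral>\<^sup>+p. ennreal (1 / sqrt (fst p)) \<partial>(profile_dist :: 'd::finite profile measure)) < \<infinity>"
  using nn_integral_inverse_sqrt_cos_finite
  by (subst nn_integral_profile_dist) (auto simp: orthant_sphere_unif.emeasure_space_1[simplified])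

text \<open>On the quarter circle c + s is at least 1, hence so is sqrt c + sqrt s; dividing by sqrt
  (c s) gives the claim. It separates the singularities at the two ends of the angle
  interval.\<close>

lemma inverse_sqrt_mult_le:
  fixes s c :: real
  assumes "0 < s" "0 < c" "s\<^sup>2 + c\<^sup>2 = 1"
  shows "1 / sqrt (c * s) \<le> 1 / sqrt c + 1 / sqrt s"
proof -
  have "1 \<le> c + s"
  proof (rule power2_le_imp_le)
    have "0 < c * s" using assms by simp
    then show "1\<^sup>2 \<le> (c + s)\<^sup>2" using assms(3) by (simp add: power2_sum mult.assoc)
  qed (use assms in simp)
  also have "\<dots> \<le> (sqrt c + sqrt s)\<^sup>2" using assms by (simp add: power2_sum)
  finally have "1 \<le> sqrt c + sqrt s"
    using assms by (intro power2_le_imp_le[of 1 "sqrt c + sqrt s"]) auto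
  then show ?thesis using assms by (simp add: real_sqrt_mult divide_simps)
qed

lemma nn_integral_inverse_sqrt_fst_norm_snd_finite:
  "(\<integral>\<^sup>+p. ennreal (1 / sqrt (fst p * norm (snd p))) \<partial>(profile_dist :: 'd::finite profile measure)) < \<infinity>"
proof -
  have "(\<integral>\<^sup>+p. ennreal (1 / sqrt (fst p * norm (snd p))) \<partial>(profile_dist :: 'd::finite profile measure))
     = (\<integral>\<^sup>+\<theta>. \<integral>\<^sup>+u. ennreal (1 / sqrt (cos \<theta> * norm (sin \<theta> *\<^sub>R u))) \<partial>(orthant_sphere_unif :: (real ^ 'd) measure) \<partial>angle_unif)"
    by (subst nn_integral_profile_dist) simp_all
  also have "\<dots> \<le> (\<integral>\<^sup>+\<theta>. ennreal (1 / sqrt (cos \<theta>)) + ennreal (1 / sqrt (sin \<theta>)) \<partial>angle_unif)"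
  proof (rule nn_integral_mono_AE)
    show "AE \<theta> in angle_unif. (\<integral>\<^sup>+u. ennreal (1 / sqrt (cos \<theta> * norm (sin \<theta> *\<^sub>R u))) \<partial>(orthant_sphere_unif :: (real ^ 'd) measure))
       \<le> ennreal (1 / sqrt (cos \<theta>)) + ennreal (1 / sqrt (sin \<theta>))"
      using AE_angle_unif
    proof eventually_elim
      case (elim \<theta>)
      then have pos: "0 < sin \<theta>" "0 < cos \<theta>" by (auto intro: sin_gt_zero2 cos_gt_zero)
      have "(\<integral>\<^sup>+u. ennreal (1 / sqrt (cos \<theta> * norm (sin \<theta> *\<^sub>R u))) \<partial>(orthant_sphere_unif :: (real ^ 'd) measure))
        \<le> (\<integral>\<^sup>+u. ennreal (1 / sqrt (cos \<theta> * sin \<theta>)) \<partial>(orthant_sphere_unif :: (real ^ 'd) measure))"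
        using AE_orthant_sphere_unif pos by (intro nn_integral_mono_AE) (auto elim!: eventually_mono)
      also have "\<dots> = ennreal (1 / sqrt (cos \<theta> * sin \<theta>))"
        by (simp add: orthant_sphere_unif.emeasure_space_1[simplified])
      also have "\<dots> \<le> ennreal (1 / sqrt (cos \<theta>) + 1 / sqrt (sin \<theta>))"
        using pos by (intro ennreal_leI inverse_sqrt_mult_le) auto
      finally show ?case using pos by (subst (asm) ennreal_plus) auto
    qed
  qed
  also have "\<dots> < \<infinity>"
    using nn_integral_inverse_sqrt_cos_finite nn_integral_inverse_sqrt_sin_finite
    by (subst nn_integral_add) auto
  finally show ?thesis .
qed

text \<open>Each orthogonal component is sin \<theta> times a coordinate of the independent uniform
  direction, so its inverse square root splits into two factors of finite mean.\<close>

lemma nn_integral_sum_inverse_sqrt_snd_finite: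
  "(\<integral>\<^sup>+p. (\<Sum>i\<in>UNIV. ennreal (1 / sqrt (snd p $ i))) \<partial>(profile_dist :: 'd::finite profile measure)) < \<infinity>"
proof -
  have "(\<integral>\<^sup>+p. ennreal (1 / sqrt (snd p $ i)) \<partial>(profile_dist :: 'd::finite profile measure)) < \<infinity>" for i
  proof -
    have "(\<integral>\<^sup>+p. ennreal (1 / sqrt (snd p $ i)) \<partial>(profile_dist :: 'd::finite profile measure))
      = (\<integral>\<^sup>+\<theta>. \<integral>\<^sup>+u. ennreal (1 / sqrt (sin \<theta> * u $ i)) \<partial>(orthant_sphere_unif :: (real ^ 'd) measure) \<partial>angle_unif)"
      by (subst nn_integral_profile_dist) simp_all
    also have "\<dots> \<le> (\<integral>\<^sup>+\<theta>. ennreal (1 / sqrt (sin \<theta>)) *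
        (\<integral>\<^sup>+u. ennreal (1 / sqrt (u $ i)) \<partial>(orthant_sphere_unif :: (real ^ 'd) measure)) \<partial>angle_unif)"
    proof (rule nn_integral_mono_AE)
      show "AE \<theta> in angle_unif. (\<integral>\<^sup>+u. ennreal (1 / sqrt (sin \<theta> * u $ i)) \<partial>(orthant_sphere_unif :: (real ^ 'd) measure))
         \<le> ennreal (1 / sqrt (sin \<theta>)) * (\<integral>\<^sup>+u. ennreal (1 / sqrt (u $ i)) \<partial>(orthant_sphere_unif :: (real ^ 'd) measure))"
        using AE_angle_unif
      proof eventually_elim
        case (elim \<theta>)
        then have "0 < sin \<theta>" by (auto intro: sin_gt_zero2)
        then show ?case
          by (subst nn_integral_cmult[symmetric])
             (auto intro!: nn_integral_mono simp: real_sqrt_mult simp flip: ennreal_mult')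
      qed
    qed
    also have "\<dots> = (\<integral>\<^sup>+\<theta>. ennreal (1 / sqrt (sin \<theta>)) \<partial>angle_unif) *
        (\<integral>\<^sup>+u. ennreal (1 / sqrt (u $ i)) \<partial>(orthant_sphere_unif :: (real ^ 'd) measure))"
      by (rule nn_integral_multc) simp
    also have "\<dots> < \<infinity>"
      using nn_integral_inverse_sqrt_sin_finite nn_integral_inverse_sqrt_component_finite[of i]
      by (simp add: ennreal_mult_less_top)
    finally show ?thesis .
  qed
  then show ?thesis by (subst nn_integral_sum) auto
qed

lemma exp_le_chord:
  fixes a z :: real
  assumes "0 \<le> a" "a \<le> 1"
  shows "exp (- (a * z)) \<le> 1 - a * (1 - exp (- z))"
  using convex_onD[OF exp_convex, of a 0 "- z"] assms by (simp add: algebra_simps)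

text \<open>The chord bound is linear in the cosine, so averaging it only takes the mean of cos
  \<theta>, which is 2 / pi.\<close>

lemma nn_integral_exp_fst_le:
  assumes "0 \<le> z"
  shows "(\<integral>\<^sup>+p. ennreal (exp (- (fst p * z))) \<partial>(profile_dist :: 'd::finite profile measure))
    \<le> ennreal (1 - 2 / pi * (1 - exp (- z)))"
proof -
  have "(\<integral>\<^sup>+p. ennreal (exp (- (fst p * z))) \<partial>(profile_dist :: 'd::finite profile measure))
     = (\<integral>\<^sup>+\<theta>. ennreal (exp (- (cos \<theta> * z))) \<partial>angle_unif)"
    by (subst nn_integral_profile_dist) (auto simp: orthant_sphere_unif.emeasure_space_1[simplified])
  also have "\<dots> = (\<integral>\<^sup>+\<theta>. ennreal (exp (- (cos \<theta> * z))) * indicator {0..pi/2} \<theta> \<partial>lborel) / ennreal (pi / 2)"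
    unfolding angle_unif_def by (subst nn_integral_uniform_measure) simp_all
  also have "\<dots> \<le> (\<integral>\<^sup>+\<theta>. ennreal (1 - cos \<theta> * (1 - exp (- z))) * indicator {0..pi/2} \<theta> \<partial>lborel) / ennreal (pi / 2)"
    by (intro divide_right_mono_ennreal nn_integral_mono)
       (auto intro!: ennreal_leI exp_le_chord cos_ge_zero split: split_indicator)
  also have "(\<integral>\<^sup>+\<theta>. ennreal (1 - cos \<theta> * (1 - exp (- z))) * indicator {0..pi/2} \<theta> \<partial>lborel)
     = ennreal ((pi/2 - sin (pi/2) * (1 - exp (- z))) - (0 - sin 0 * (1 - exp (- z))))"
  proof (rule nn_integral_FTC_Icc[where F = "\<lambda>x. x - sin x * (1 - exp (- z))"])
    fix x :: real assume "x \<in> {0..pi/2}"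
    have "cos x * (1 - exp (- z)) \<le> 1 * 1" using assms by (intro mult_mono) auto
    then show "0 \<le> 1 - cos x * (1 - exp (- z))" by simp
  qed (auto intro!: derivative_eq_intros)
  also have "\<dots> / ennreal (pi / 2) = ennreal (1 - 2 / pi * (1 - exp (- z)))"
  proof -
    have "0 \<le> pi/2 - (1 - exp (- z))" using pi_gt3 exp_gt_zero[of "- z"] by linarith
    then show ?thesis by (simp add: divide_ennreal field_simps)
  qed
  finally show ?thesis .
qed

section \<open>Pathwise bound on the delivery time\<close>

text \<open>The minimum is at most the quotient with the larger denominator, and the larger of
  \<open>a\<close> and \<open>b\<close> is at least their geometric mean. Adding both numerators
  makes the bound symmetric, so one ordering of \<open>a\<close> and \<open>b\<close>
  suffices.\<close>

lemma min_divide_le: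
  fixes x y a b :: real
  assumes "0 \<le> x" "0 \<le> y" "0 < a" "0 < b"
  shows "min (x / a) (y / b) \<le> (x + y) * (1 / (sqrt a * sqrt b))"
proof -
  have "min (x / a) (y / b) \<le> (x + y) * (1 / (sqrt a * sqrt b))"
    if "0 \<le> x" "0 \<le> y" "0 < a" "0 < b" "b \<le> a" for x y a b :: real
  proof -
    have "min (x / a) (y / b) \<le> x / (sqrt a * sqrt a)" using that by simp
    also have "\<dots> \<le> x / (sqrt a * sqrt b)"
      using that by (intro divide_left_mono mult_left_mono mult_pos_pos) auto
    also have "\<dots> \<le> (x + y) / (sqrt a * sqrt b)"
      using that by (intro divide_right_mono) auto
    finally show ?thesis by simp
  qed
  from this[of x y a b] this[of y x b a] assms show ?thesis
    by (cases "b \<le> a") (auto simp: min.commute mult.commute add.commute)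
qed

text \<open>Take \<open>i\<close> to be the index of the smallest component of \<open>v\<close>: the
  inner product is at least that component times the l1 norm of \<open>w\<close>, which dominates
  the Euclidean norm. The two vectors are thereby separated.\<close>

lemma inner_profile_ge:
  fixes v w :: "real ^ 'd::finite"
  assumes "\<And>i. 0 < v $ i" "\<And>i. 0 < w $ i"
  obtains i where "v $ i * norm w \<le> v \<bullet> w"
proof
  define m where "m = Min (range (\<lambda>i. v $ i))"
  define i where "i = (SOME i. v $ i = m)"
  have "m \<in> range (\<lambda>i. v $ i)" unfolding m_def by (intro Min_in) auto
  then have i: "v $ i = m" unfolding i_def by (metis (mono_tags, lifting) rangeE someI)
  have le: "m \<le> v $ j" for j unfolding m_def by (intro Min_le) auto
  have "norm w \<le> (\<Sum>j\<in>UNIV. w $ j)"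
    using norm_le_l1_cart[of w] assms(2) by (simp add: less_imp_le)
  then have "m * norm w \<le> (\<Sum>j\<in>UNIV. m * w $ j)"
    using i assms(1)[of i] by (simp flip: sum_distrib_left)
  also have "\<dots> \<le> (\<Sum>j\<in>UNIV. v $ j * w $ j)"
    using le assms(2) by (intro sum_mono mult_right_mono) (auto simp: less_imp_le)
  finally show "v $ i * norm w \<le> v \<bullet> w" using i by (simp add: inner_vec_def)
qed

text \<open>Under the square root, \<open>fst p\<close> comes from the rate of (S, D) and
  \<open>norm (snd p)\<close> from the part of the rate of (relay, D) orthogonal to S. For a profile
  at angle \<theta> to S the product is cos \<theta> sin \<theta>.\<close>

definition dst_weight :: "'d::finite profile \<Rightarrow> ennreal" where
  "dst_weight p = ennreal (1 / sqrt (fst p * norm (snd p)))"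

text \<open>The sum dominates the inverse square root of the smallest component, whichever
  coordinate that is.\<close>

definition relay_weight :: "'d::finite profile \<Rightarrow> ennreal" where
  "relay_weight p = (\<Sum>i\<in>UNIV. ennreal (1 / sqrt (snd p $ i)))"

lemma measurable_dst_weight [measurable]: "dst_weight \<in> borel_measurable borel"
  unfolding dst_weight_def by measurable

lemma measurable_relay_weight [measurable]: "relay_weight \<in> borel_measurable borel"
  unfolding relay_weight_def by measurable

lemma sqrt_rate_le:
  fixes p q :: "'d::finite profile"
  assumes "interior_profile p" "interior_profile q" "0 < k" "0 < \<delta>"
  shows "ennreal (1 / (sqrt (k * fst q + \<delta>) * sqrt (k * (p \<bullet> q) + \<delta>)))
    \<le> ennreal (1 / k) * dst_weight q * relay_weight p"
proof -
  have pos: "0 < fst p" "0 < fst q" "\<And>i. 0 < snd p $ i" "\<And>i. 0 < snd q $ i"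
    using assms by (auto simp: interior_profile_def)
  obtain i where i: "snd p $ i * norm (snd q) \<le> snd p \<bullet> snd q"
    using inner_profile_ge[OF pos(3,4)] .
  let ?d = "fst q * norm (snd q)" and ?r = "snd p $ i"
  have "0 < norm (snd q)" using pos(4) by (auto simp: vec_eq_iff less_le)
  then have d: "0 < ?d" using pos by simp
  have "sqrt ?d * sqrt ?r * k = sqrt (k * fst q) * sqrt (k * (?r * norm (snd q)))"
    using assms(3) pos by (simp add: real_sqrt_mult)
  also have "\<dots> \<le> sqrt (k * fst q + \<delta>) * sqrt (k * (p \<bullet> q) + \<delta>)"
  proof (intro mult_mono real_sqrt_le_mono)
    \<comment> \<open>The product of the first coordinates is positive and is dropped; keeping only
      the orthogonal part avoids a second factor \<open>fst q\<close> under the root.\<close>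
    have "?r * norm (snd q) \<le> p \<bullet> q"
      using i mult_pos_pos[OF pos(1,2)] by (simp add: inner_prod_def)
    then have "k * (?r * norm (snd q)) \<le> k * (p \<bullet> q)" using assms(3) by simp
    then show "k * (?r * norm (snd q)) \<le> k * (p \<bullet> q) + \<delta>" using assms(4) by linarith
  qed (use assms pos in \<open>auto simp: less_imp_le\<close>)
  finally have le: "sqrt ?d * sqrt ?r * k \<le> sqrt (k * fst q + \<delta>) * sqrt (k * (p \<bullet> q) + \<delta>)" .
  have "0 < sqrt ?d * sqrt ?r * k" using d pos(3)[of i] assms(3) by (intro mult_pos_pos) auto
  with le have "0 < sqrt (k * fst q + \<delta>) * sqrt (k * (p \<bullet> q) + \<delta>)" by linarith
  with le \<open>0 < sqrt ?d * sqrt ?r * k\<close>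
  have "1 / (sqrt (k * fst q + \<delta>) * sqrt (k * (p \<bullet> q) + \<delta>)) \<le> 1 / (sqrt ?d * sqrt ?r * k)"
    by (intro divide_left_mono[OF le]) (auto intro: mult_pos_pos)
  also have "\<dots> = 1 / k * (1 / sqrt ?d) * (1 / sqrt ?r)" by simp
  finally have "ennreal (1 / (sqrt (k * fst q + \<delta>) * sqrt (k * (p \<bullet> q) + \<delta>)))
    \<le> ennreal (1 / k * (1 / sqrt ?d) * (1 / sqrt ?r))" by (rule ennreal_leI)
  also have "\<dots> = ennreal (1 / k) * dst_weight q * ennreal (1 / sqrt ?r)"
    using d pos(3)[of i] assms(3) unfolding dst_weight_def
    by (subst ennreal_mult | simp)+
  also have "\<dots> \<le> ennreal (1 / k) * dst_weight q * relay_weight p"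
    unfolding relay_weight_def
    by (intro mult_left_mono member_le_sum) auto
  finally show ?thesis .
qed

lemma finite_nodes_with_profile [simp]: "finite (nodes_with_profile n)"
  by (simp add: nodes_with_profile_def)

lemma finite_node_pairs [simp]: "finite (node_pairs n)"
proof -
  have "node_pairs n \<subseteq> Pow (all_nodes n)" by (auto simp: node_pairs_def)
  moreover have "finite (all_nodes n)" by (simp add: all_nodes_def)
  ultimately show ?thesis using finite_subset[of "node_pairs n" "Pow (all_nodes n)"] by simp
qed

lemma node_pairs_intros [simp, intro]:
  "{Src, Dst} \<in> node_pairs n"
  "j \<in> {1..n} \<Longrightarrow> {Src, Rel j} \<in> node_pairs n"
  "j \<in> {1..n} \<Longrightarrow> {Rel j, Dst} \<in> node_pairs n"
proof -
  have pair: "{A, B} \<in> node_pairs n" if "A \<in> all_nodes n" "B \<in> all_nodes n" "A \<noteq> B" for A B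
    using that unfolding node_pairs_def by blast
  show "{Src, Dst} \<in> node_pairs n"
    and "j \<in> {1..n} \<Longrightarrow> {Src, Rel j} \<in> node_pairs n"
    and "j \<in> {1..n} \<Longrightarrow> {Rel j, Dst} \<in> node_pairs n"
    by (rule pair; simp add: all_nodes_def nodes_with_profile_def)+
qed

lemma meet_rate_Src:
  "X \<noteq> Src \<Longrightarrow> meet_rate k \<delta> p Src X = k * fst (p X) + \<delta>"
  by (simp add: meet_rate_def prof_def src_profile_def inner_prod_def)

lemma meet_time_arrival:
  "meet_time k \<delta> (p, e) A B i = arrival (e {A, B}) i / meet_rate k \<delta> p A B"
  by (simp add: meet_time_def arrival_def)

text \<open>On the unit-rate clock of the pair, real time \<open>t\<close> reads rate times
  \<open>t\<close>, and a residual \<open>a\<close> there lasts \<open>a\<close> divided by the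
  rate. The witness \<open>a\<close> is real, so that the minimum over two pairs can be estimated in
  the reals before passing to \<open>ennreal\<close>.\<close>

lemma next_meet_le:
  assumes rate: "0 < meet_rate k \<delta> p A B" and t: "\<And>t. \<exists>i. t < arrival (e {A, B}) i"
  obtains a where "0 \<le> a" "ennreal a \<le> residual (meet_rate k \<delta> p A B * t) (e {A, B})"
    "next_meet k \<delta> (p, e) A B t \<le> t + a / meet_rate k \<delta> p A B"
proof -
  let ?r = "meet_rate k \<delta> p A B"
  obtain i where i: "?r * t < arrival (e {A, B}) i"
    "ennreal (arrival (e {A, B}) i - ?r * t) \<le> residual (?r * t) (e {A, B})"
    by (rule residual_ge[OF t])
  have "next_meet k \<delta> (p, e) A B t \<le> meet_time k \<delta> (p, e) A B i"
    unfolding next_meet_def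
  proof (rule cInf_lower)
    have "t < meet_time k \<delta> (p, e) A B i"
      using i(1) rate by (simp add: meet_time_arrival field_simps)
    then show "meet_time k \<delta> (p, e) A B i \<in> {meet_time k \<delta> (p, e) A B i |i. t < meet_time k \<delta> (p, e) A B i}"
      by blast
    show "bdd_below {meet_time k \<delta> (p, e) A B i |i. t < meet_time k \<delta> (p, e) A B i}"
      by (rule bdd_belowI[of _ t]) auto
  qed
  also have "\<dots> = t + (arrival (e {A, B}) i - ?r * t) / ?r"
    using rate by (simp add: meet_time_arrival field_simps)
  finally show thesis using i by (intro that[of "arrival (e {A, B}) i - ?r * t"]) auto
qed

text \<open>With \<kappa> = k / (k + \<delta>) this is the indicator of an event containing the
  event that S meets no relay before relay \<open>j\<close>, almost surely. As a product of 0/1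
  factors over the other relays, its mean factorises once the clock of (S, relay \<open>j\<close>)
  is fixed.\<close>

definition relay_first :: "nat \<Rightarrow> real \<Rightarrow> (node \<Rightarrow> 'd::finite profile) \<Rightarrow> (node set \<Rightarrow> nat \<Rightarrow> real) \<Rightarrow> nat \<Rightarrow> ennreal" where
  "relay_first n \<kappa> p e j =
     (\<Prod>i\<in>{1..n} - {j}. if \<kappa> * fst (p (Rel i)) * e {Src, Rel j} 0 \<le> e {Src, Rel i} 0 then 1 else 0)"

text \<open>The maximum with 0 only matters on a null set: it keeps the Poisson time nonnegative everywhere.\<close>

definition poisson_clock :: "real \<Rightarrow> real \<Rightarrow> (node \<Rightarrow> 'd::finite profile) \<Rightarrow> (node set \<Rightarrow> nat \<Rightarrow> real) \<Rightarrow> node \<Rightarrow> nat \<Rightarrow> real" where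
  "poisson_clock k \<delta> p e A j =
     max 0 (meet_rate k \<delta> p A Dst * (e {Src, Rel j} 0 / meet_rate k \<delta> p Src (Rel j)))"

text \<open>In both routing cases the first contact of S occurs no later than its contacts with
  relays 1 and 2, which gives the first summand; if D comes first, that already suffices. Otherwise
  the random index of the chosen relay is replaced by a sum over all \<open>j\<close>, in which
  \<open>relay_first\<close> equals 1 at the chosen one.\<close>

lemma fm_delivery_time_le:
  fixes p :: "node \<Rightarrow> 'd::finite profile"
  assumes n: "2 \<le> n" and k: "0 < k" and \<delta>: "0 < \<delta>" and \<kappa>: "\<kappa> = k / (k + \<delta>)"
    and p: "\<And>X. X \<in> nodes_with_profile n \<Longrightarrow> interior_profile (p X)"
    and e0: "\<And>q. q \<in> node_pairs n \<Longrightarrow> 0 \<le> e q 0"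
    and e: "\<And>q t. q \<in> node_pairs n \<Longrightarrow> \<exists>i. t < arrival (e q) i"
  shows "ennreal (fm_delivery_time n k \<delta> (p, e)) \<le>
     ennreal (1 / k) * (ennreal (1 / sqrt (fst (p (Rel 1)))) * ennreal (1 / sqrt (fst (p (Rel 2)))))
       * (ennreal (e {Src, Rel 1} 0) + ennreal (e {Src, Rel 2} 0))
     + (\<Sum>j\<in>{1..n}. ennreal (1 / k) * dst_weight (p Dst) * relay_weight (p (Rel j)) *
         (relay_first n \<kappa> p e j * (residual (poisson_clock k \<delta> p e Src j) (e {Src, Dst})
            + residual (poisson_clock k \<delta> p e (Rel j) j) (e {Rel j, Dst}))))"
    (is "_ \<le> ?A + (\<Sum>j\<in>_. ?B j)")
proof -
  define F where "F X = meet_time k \<delta> (p, e) Src X 0" for X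
  have F: "F X = e {Src, X} 0 / (k * fst (p X) + \<delta>)" if "X \<noteq> Src" for X
    using that by (simp add: F_def meet_time_arrival meet_rate_Src arrival_def)
  have relp: "interior_profile (p (Rel j))" if "j \<in> {1..n}" for j
    using that by (intro p) (simp add: nodes_with_profile_def)
  have dstp: "interior_profile (p Dst)"
    by (intro p) (simp add: nodes_with_profile_def)
  have rate: "0 < k * fst (p X) + \<delta>" if "interior_profile (p X)" for X
    using that k \<delta> by (simp add: interior_profile_def add_pos_pos)
  have F0: "0 \<le> F X" if "X \<in> nodes_with_profile n" for X
    using that p[OF that] rate[of X] e0
    by (subst F) (auto simp: nodes_with_profile_def intro!: divide_nonneg_pos)
  \<comment> \<open>One relay would give 1 / cos, of infinite mean; two distinct relays give a
    product of two independent inverse square roots. This is the origin of the hypothesis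
    \<open>2 \<le> n\<close>.\<close>
  have A: "ennreal t \<le> ?A" if t: "t \<le> F (Rel 1)" "t \<le> F (Rel 2)" for t
  proof -
    have i: "interior_profile (p (Rel 1))" "interior_profile (p (Rel 2))" using n relp by auto
    let ?a = "fst (p (Rel 1))" and ?b = "fst (p (Rel 2))"
    let ?x = "e {Src, Rel 1} 0" and ?y = "e {Src, Rel 2} 0"
    have xy: "0 \<le> ?x" "0 \<le> ?y" using n by (auto intro!: e0)
    have ab: "0 < ?a" "0 < ?b" using i by (auto simp: interior_profile_def)
    have "t \<le> (?x + ?y) * (1 / (sqrt (k * ?a + \<delta>) * sqrt (k * ?b + \<delta>)))"
      using t by (intro order_trans[OF _ min_divide_le[OF xy rate[OF i(1)] rate[OF i(2)]]]) (simp add: F)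
    also have "\<dots> \<le> (?x + ?y) * (1 / (sqrt (k * ?a) * sqrt (k * ?b)))"
      using xy ab k \<delta> by (intro mult_left_mono divide_left_mono mult_mono mult_pos_pos) (auto simp: add_pos_pos)
    also have "\<dots> = 1 / k * (1 / sqrt ?a * (1 / sqrt ?b)) * (?x + ?y)"
      using k by (simp add: real_sqrt_mult)
    finally have "ennreal t \<le> ennreal (1 / k * (1 / sqrt ?a * (1 / sqrt ?b)) * (?x + ?y))"
      by (rule ennreal_leI)
    also have "\<dots> = ?A"
      using k ab xy by (simp only: ennreal_mult ennreal_plus divide_nonneg_nonneg zero_le_one
        less_imp_le real_sqrt_ge_zero mult_nonneg_nonneg add_nonneg_nonneg)
    finally show ?thesis .
  qed
  show ?thesis
  proof (cases "\<forall>j\<in>{1..n}. F Dst < F (Rel j)")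
    case True
    then have "fm_delivery_time n k \<delta> (p, e) = F Dst"
      by (simp add: fm_delivery_time_def F_def)
    moreover have "ennreal (F Dst) \<le> ?A" using True n by (intro A) (auto simp: less_imp_le)
    ultimately show ?thesis by (simp add: add_increasing2)
  next
    case False
    define \<tau> where "\<tau> = Min (F ` nodes_with_profile n)"
    define j where "j = (LEAST j. j \<in> {1..n} \<and> F (Rel j) = \<tau>)"
    have min_le: "\<tau> \<le> F X" if "X \<in> nodes_with_profile n" for X
      unfolding \<tau>_def using that by (intro Min_le) auto
    have "\<tau> \<in> F ` nodes_with_profile n"
      unfolding \<tau>_def by (intro Min_in) (auto simp: nodes_with_profile_def)
    \<comment> \<open>If the minimum is attained at \<open>Dst\<close>, the failed case distinction
      supplies a relay that is met no later, so by a tie it attains the minimum too.\<close>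
    then have "\<exists>j. j \<in> {1..n} \<and> F (Rel j) = \<tau>"
    proof
      fix X assume X: "\<tau> = F X" "X \<in> nodes_with_profile n"
      obtain i where i: "i \<in> {1..n}" "F (Rel i) \<le> F Dst" using False by (auto simp: not_less)
      show ?thesis
      proof (cases "X = Dst")
        case True
        have "\<tau> \<le> F (Rel i)" using i by (intro min_le) (auto simp: nodes_with_profile_def)
        with i X True show ?thesis by (intro exI[of _ i]) auto
      qed (use X in \<open>auto simp: nodes_with_profile_def\<close>)
    qed
    from LeastI_ex[OF this] have j: "j \<in> {1..n}" "F (Rel j) = \<tau>" unfolding j_def by auto
    have T: "fm_delivery_time n k \<delta> (p, e) = min (next_meet k \<delta> (p, e) Src Dst \<tau>) (next_meet k \<delta> (p, e) (Rel j) Dst \<tau>)"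
      using False
      unfolding fm_delivery_time_def Let_def F_def[symmetric] \<tau>_def[symmetric] j_def[symmetric]
      by (simp only: if_False)
    have \<tau>0: "0 \<le> \<tau>" using j F0[of "Rel j"] by (simp add: nodes_with_profile_def)
    have r1: "meet_rate k \<delta> p Src Dst = k * fst (p Dst) + \<delta>" by (simp add: meet_rate_Src)
    have r2: "meet_rate k \<delta> p (Rel j) Dst = k * (p (Rel j) \<bullet> p Dst) + \<delta>"
      by (simp add: meet_rate_def prof_def)
    have r1_pos: "0 < meet_rate k \<delta> p Src Dst" using rate[OF dstp] by (simp add: r1)
    have "0 \<le> p (Rel j) \<bullet> p Dst"
      using relp[OF j(1)] dstp unfolding interior_profile_def inner_prod_def inner_vec_def
      by (intro add_nonneg_nonneg sum_nonneg) (auto simp: less_imp_le)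
    then have r2_pos: "0 < meet_rate k \<delta> p (Rel j) Dst" using k \<delta> by (simp add: r2 add_nonneg_pos)
    obtain a where a: "0 \<le> a" "ennreal a \<le> residual (meet_rate k \<delta> p Src Dst * \<tau>) (e {Src, Dst})"
      "next_meet k \<delta> (p, e) Src Dst \<tau> \<le> \<tau> + a / meet_rate k \<delta> p Src Dst"
      by (rule next_meet_le[where t = \<tau> and e = e, OF r1_pos e]) auto
    obtain b where b: "0 \<le> b" "ennreal b \<le> residual (meet_rate k \<delta> p (Rel j) Dst * \<tau>) (e {Rel j, Dst})"
      "next_meet k \<delta> (p, e) (Rel j) Dst \<tau> \<le> \<tau> + b / meet_rate k \<delta> p (Rel j) Dst"
      by (rule next_meet_le[where t = \<tau> and e = e, OF r2_pos e]) (use j(1) in auto)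
    have \<tau>_eq: "\<tau> = e {Src, Rel j} 0 / meet_rate k \<delta> p Src (Rel j)"
      using j F[of "Rel j"] by (simp add: meet_rate_Src)
    have clock: "poisson_clock k \<delta> p e Src j = meet_rate k \<delta> p Src Dst * \<tau>"
      "poisson_clock k \<delta> p e (Rel j) j = meet_rate k \<delta> p (Rel j) Dst * \<tau>"
      using \<tau>0 r1_pos r2_pos by (simp_all add: poisson_clock_def flip: \<tau>_eq)
    \<comment> \<open>Cross-multiplying \<open>F (Rel j) \<le> F (Rel i)\<close>, then dropping
      \<delta> on the left and using that the cosine of \<open>j\<close> is at most 1 on the right,
      removes the profile of \<open>j\<close> and produces the factor \<kappa>.\<close>
    have first: "relay_first n \<kappa> p e j = 1"
      unfolding relay_first_def
    proof (intro prod.neutral ballI)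
      fix i assume i: "i \<in> {1..n} - {j}"
      let ?ai = "fst (p (Rel i))" and ?aj = "fst (p (Rel j))"
      have ij: "interior_profile (p (Rel i))" "interior_profile (p (Rel j))" using i j relp by auto
      have "F (Rel j) \<le> F (Rel i)" using i j by (simp add: min_le nodes_with_profile_def)
      then have *: "e {Src, Rel j} 0 * (k * ?ai + \<delta>) \<le> e {Src, Rel i} 0 * (k * ?aj + \<delta>)"
        using rate[OF ij(1)] rate[OF ij(2)] by (simp add: F field_simps)
      have nn: "0 \<le> e {Src, Rel j} 0" "0 \<le> e {Src, Rel i} 0" using i j by (auto intro!: e0)
      have "e {Src, Rel j} 0 * (k * ?ai) \<le> e {Src, Rel j} 0 * (k * ?ai + \<delta>)"
        using nn \<delta> by (intro mult_left_mono) auto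
      also note *
      also have "e {Src, Rel i} 0 * (k * ?aj + \<delta>) \<le> e {Src, Rel i} 0 * (k + \<delta>)"
        using nn k ij by (intro mult_left_mono) (auto simp: interior_profile_def mult_left_le)
      finally show "(if \<kappa> * ?ai * e {Src, Rel j} 0 \<le> e {Src, Rel i} 0 then 1 else 0) = (1 :: ennreal)"
        using k \<delta> by (simp add: \<kappa> field_simps add_pos_pos)
    qed
    let ?w = "1 / (sqrt (k * fst (p Dst) + \<delta>) * sqrt (k * (p (Rel j) \<bullet> p Dst) + \<delta>))"
    have w: "0 \<le> ?w" using r1_pos r2_pos unfolding r1 r2 by simp
    have "fm_delivery_time n k \<delta> (p, e) \<le> \<tau> + min (a / meet_rate k \<delta> p Src Dst) (b / meet_rate k \<delta> p (Rel j) Dst)"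
      using a(3) b(3) unfolding T by linarith
    also have "\<dots> \<le> \<tau> + (a + b) * ?w"
      using min_divide_le[OF a(1) b(1) r1_pos r2_pos] unfolding r1 r2 by simp
    finally have "ennreal (fm_delivery_time n k \<delta> (p, e)) \<le> ennreal (\<tau> + ?w * (a + b))"
      by (intro ennreal_leI) (simp add: mult.commute)
    also have "\<dots> = ennreal \<tau> + ennreal ?w * (ennreal a + ennreal b)"
      using \<tau>0 w a(1) b(1) by (simp only: ennreal_mult ennreal_plus mult_nonneg_nonneg add_nonneg_nonneg)
    also have "\<dots> \<le> ?A + ?B j"
    proof (intro add_mono A)
      show "ennreal ?w * (ennreal a + ennreal b) \<le> ?B j"
        unfolding first clock
        using a(2) b(2) sqrt_rate_le[OF relp[OF j(1)] dstp k \<delta>]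
        by (simp only: mult_1_left) (intro mult_mono add_mono, auto)
    qed (use n in \<open>auto intro!: min_le simp: nodes_with_profile_def\<close>)
    also have "?B j \<le> (\<Sum>j\<in>{1..n}. ?B j)"
      using j by (intro member_le_sum) auto
    finally show ?thesis by (simp add: add_mono)
  qed
qed

section \<open>Expectation of the bound\<close>

lemma AE_pair_fst:
  assumes "sigma_finite_measure N" "AE x in M. P x"
  shows "AE z in M \<Otimes>\<^sub>M N. P (fst z)"
proof -
  interpret N: sigma_finite_measure N by fact
  obtain B where B: "{x \<in> space M. \<not> P x} \<subseteq> B" "emeasure M B = 0" "B \<in> sets M"
    by (rule AE_E[OF assms(2)])
  have "emeasure (M \<Otimes>\<^sub>M N) (B \<times> space N) = 0"
    using B by (simp add: N.emeasure_pair_measure_Times)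
  then show ?thesis using B by (intro AE_I[where N = "B \<times> space N"]) (auto simp: space_pair_measure)
qed

lemma AE_pair_snd:
  assumes "sigma_finite_measure N" "AE y in N. P y"
  shows "AE z in M \<Otimes>\<^sub>M N. P (snd z)"
proof -
  interpret N: sigma_finite_measure N by fact
  obtain B where B: "{x \<in> space N. \<not> P x} \<subseteq> B" "emeasure N B = 0" "B \<in> sets N"
    by (rule AE_E[OF assms(2)])
  have "emeasure (M \<Otimes>\<^sub>M N) (space M \<times> B) = 0"
    using B by (simp add: N.emeasure_pair_measure_Times)
  then show ?thesis using B by (intro AE_I[where N = "space M \<times> B"]) (auto simp: space_pair_measure)
qed

section \<open>Measurability of the terms of the bound\<close>

abbreviation profiles :: "nat \<Rightarrow> (node \<Rightarrow> 'd::finite profile) measure" where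
  "profiles n \<equiv> PiM (nodes_with_profile n) (\<lambda>_. profile_dist)"

abbreviation clocks :: "nat \<Rightarrow> (node set \<Rightarrow> nat \<Rightarrow> real) measure" where
  "clocks n \<equiv> PiM (node_pairs n) (\<lambda>_. unit_poisson)"

lemma prob_space_profiles: "prob_space (profiles n)"
  by (intro prob_space_PiM prob_space_profile_dist)

lemma prob_space_clocks: "prob_space (clocks n)"
  by (intro prob_space_PiM prob_space_unit_poisson)

lemma measurable_profile_component [measurable]:
  "X \<in> nodes_with_profile n \<Longrightarrow> (\<lambda>p. p X) \<in> profiles n \<rightarrow>\<^sub>M (borel :: 'd::finite profile measure)"
  using measurable_component_singleton[of X "nodes_with_profile n" "\<lambda>_. profile_dist :: 'd profile measure"]
  by (simp cong: measurable_cong_sets)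

lemma measurable_clock [measurable (raw)]:
  assumes "f \<in> N \<rightarrow>\<^sub>M clocks n" "q \<in> node_pairs n"
  shows "(\<lambda>z. f z q) \<in> N \<rightarrow>\<^sub>M unit_poisson"
  using measurable_compose[OF assms(1) measurable_component_singleton[OF assms(2)]] .

lemma measurable_clock_component [measurable (raw)]:
  assumes "f \<in> N \<rightarrow>\<^sub>M clocks n" "q \<in> node_pairs n"
  shows "(\<lambda>z. f z q i) \<in> borel_measurable N"
  using measurable_compose[OF measurable_clock[OF assms] measurable_component_unit_poisson] .

lemma nodes_with_profile_intros [simp, intro]:
  "Dst \<in> nodes_with_profile n" "j \<in> {1..n} \<Longrightarrow> Rel j \<in> nodes_with_profile n"
  by (auto simp: nodes_with_profile_def)

lemma measurable_relay_fst [measurable (raw)]: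
  assumes "g \<in> N \<rightarrow>\<^sub>M (profiles n :: (node \<Rightarrow> 'd::finite profile) measure)" "X \<in> nodes_with_profile n"
  shows "(\<lambda>z. fst (g z X)) \<in> borel_measurable N"
  using measurable_compose[OF measurable_compose[OF assms(1) measurable_profile_component[OF assms(2)]]
    measurable_fst_profile] .

lemma measurable_relay_first [measurable (raw)]:
  assumes [measurable]: "g \<in> N \<rightarrow>\<^sub>M (profiles n :: (node \<Rightarrow> 'd::finite profile) measure)"
    "f \<in> N \<rightarrow>\<^sub>M clocks n" and j: "j \<in> {1..n}"
  shows "(\<lambda>z. relay_first n \<kappa> (g z) (f z) j) \<in> borel_measurable N"
  unfolding relay_first_def
proof (intro borel_measurable_prod_ennreal)
  fix i assume i: "i \<in> {1..n} - {j}"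
  have [measurable]: "Rel i \<in> nodes_with_profile n" "{Src, Rel i} \<in> node_pairs n"
    "{Src, Rel j} \<in> node_pairs n"
    using i j by auto
  show "(\<lambda>z. if \<kappa> * fst (g z (Rel i)) * f z {Src, Rel j} 0 \<le> f z {Src, Rel i} 0 then 1 else 0 :: ennreal)
    \<in> borel_measurable N"
    by measurable
qed

lemma measurable_meet_rate [measurable (raw)]:
  assumes [measurable]: "g \<in> N \<rightarrow>\<^sub>M (profiles n :: (node \<Rightarrow> 'd::finite profile) measure)"
    and "A \<in> all_nodes n" "B \<in> all_nodes n"
  shows "(\<lambda>z. meet_rate k \<delta> (g z) A B) \<in> borel_measurable N"
proof -
  have prof [measurable]: "(\<lambda>z. prof (g z) X) \<in> borel_measurable N" if "X \<in> all_nodes n" for X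
  proof (cases "X = Src")
    case False
    then have [measurable]: "X \<in> nodes_with_profile n" using that by (auto simp: all_nodes_def)
    from False show ?thesis
      using measurable_compose[OF assms(1) measurable_profile_component[of X]] by (simp add: prof_def)
  qed (simp add: prof_def)
  show ?thesis
    using assms(2,3) unfolding meet_rate_def by measurable
qed

lemma all_nodes_intros [simp, intro]:
  "Src \<in> all_nodes n" "Dst \<in> all_nodes n" "j \<in> {1..n} \<Longrightarrow> Rel j \<in> all_nodes n"
  by (auto simp: all_nodes_def)

lemma measurable_poisson_clock [measurable (raw)]:
  assumes [measurable]: "g \<in> N \<rightarrow>\<^sub>M (profiles n :: (node \<Rightarrow> 'd::finite profile) measure)"
    "f \<in> N \<rightarrow>\<^sub>M clocks n" and j: "j \<in> {1..n}" "A \<in> all_nodes n"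
  shows "(\<lambda>z. poisson_clock k \<delta> (g z) (f z) A j) \<in> borel_measurable N"
proof -
  have [measurable]: "{Src, Rel j} \<in> node_pairs n" "Rel j \<in> all_nodes n" "Dst \<in> all_nodes n"
    "Src \<in> all_nodes n" "A \<in> all_nodes n" using j by auto
  show ?thesis unfolding poisson_clock_def by measurable
qed

text \<open>With profiles fixed, the clock of (S, relay \<open>j\<close>) is redrawn and moved to
  the outer integral. Given its first arrival s, the clocks of the other relays are independent, and
  each has its first arrival after \<kappa> s times the relay's cosine with at most the stated
  exponential probability.\<close>

lemma nn_integral_relay_first_le:
  fixes p :: "node \<Rightarrow> 'd::finite profile"
  assumes j: "j \<in> {1..n}" and p: "p \<in> space (profiles n)"
  shows "(\<integral>\<^sup>+e. relay_first n \<kappa> p e j \<partial>clocks n)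
     \<le> (\<integral>\<^sup>+s. (\<Prod>i\<in>{1..n} - {j}. ennreal (exp (- (fst (p (Rel i)) * (\<kappa> * s))))) \<partial>exp1)"
proof -
  interpret C: prob_space "clocks n" by (rule prob_space_clocks)
  interpret U: prob_space unit_poisson by (rule prob_space_unit_poisson)
  interpret CU: pair_sigma_finite "clocks n" unit_poisson ..
  let ?I = "{1..n} - {j}"
  let ?f = "\<lambda>i y z. if \<kappa> * fst (p (Rel i)) * y 0 \<le> z 0 then 1 else 0 :: ennreal"
  have pairs: "{Src, Rel i} \<in> node_pairs n" if "i \<in> ?I" for i using that by auto
  have [measurable]: "(\<lambda>_. p) \<in> clocks n \<rightarrow>\<^sub>M profiles n" using p by simp
  have meas: "(\<lambda>(e, y). \<Prod>i\<in>?I. ?f i y (e {Src, Rel i})) \<in> borel_measurable (clocks n \<Otimes>\<^sub>M unit_poisson)"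
    unfolding split_beta'
  proof (intro borel_measurable_prod_ennreal)
    fix i assume i: "i \<in> ?I"
    note [measurable] = pairs[OF i]
    show "(\<lambda>z. ?f i (snd z) (fst z {Src, Rel i})) \<in> borel_measurable (clocks n \<Otimes>\<^sub>M unit_poisson)"
      by measurable
  qed
  have "(\<integral>\<^sup>+e. relay_first n \<kappa> p e j \<partial>clocks n)
     = (\<integral>\<^sup>+e. \<integral>\<^sup>+y. relay_first n \<kappa> p (e({Src, Rel j} := y)) j \<partial>unit_poisson \<partial>clocks n)"
    using j by (intro nn_integral_PiM_resample prob_space_unit_poisson measurable_relay_first) auto
  also have "\<dots> = (\<integral>\<^sup>+e. \<integral>\<^sup>+y. (\<Prod>i\<in>?I. ?f i y (e {Src, Rel i})) \<partial>unit_poisson \<partial>clocks n)"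
    unfolding relay_first_def by (intro nn_integral_cong prod.cong) (auto simp: doubleton_eq_iff)
  also have "\<dots> = (\<integral>\<^sup>+y. \<integral>\<^sup>+e. (\<Prod>i\<in>?I. ?f i y (e {Src, Rel i})) \<partial>clocks n \<partial>unit_poisson)"
    by (rule CU.Fubini'[OF meas, symmetric])
  also have "\<dots> = (\<integral>\<^sup>+y. (\<Prod>i\<in>?I. \<integral>\<^sup>+z. ?f i y z \<partial>unit_poisson) \<partial>unit_poisson)"
    by (intro nn_integral_cong nn_integral_PiM_prod_inj[where h = "\<lambda>i. {Src, Rel i}"] prob_space_unit_poisson)
       (auto simp: inj_on_def doubleton_eq_iff)
  also have "\<dots> \<le> (\<integral>\<^sup>+y. (\<Prod>i\<in>?I. ennreal (exp (- (fst (p (Rel i)) * (\<kappa> * y 0))))) \<partial>unit_poisson)"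
  proof (intro nn_integral_mono prod_mono_ennreal)
    fix y i
    have "(\<integral>\<^sup>+z. ?f i y z \<partial>unit_poisson)
        = (\<integral>\<^sup>+s. (if \<kappa> * fst (p (Rel i)) * y 0 \<le> s then 1 else 0) \<partial>exp1)"
      by (rule nn_integral_unit_poisson_0) simp
    also have "\<dots> \<le> ennreal (exp (- (\<kappa> * fst (p (Rel i)) * y 0)))" by (rule exp1_atLeast_le)
    finally show "(\<integral>\<^sup>+z. ?f i y z \<partial>unit_poisson) \<le> ennreal (exp (- (fst (p (Rel i)) * (\<kappa> * y 0))))"
      by (simp add: mult_ac)
  qed
  also have "\<dots> = (\<integral>\<^sup>+s. (\<Prod>i\<in>?I. ennreal (exp (- (fst (p (Rel i)) * (\<kappa> * s))))) \<partial>exp1)"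
    by (rule nn_integral_unit_poisson_0) measurable
  finally show ?thesis .
qed

text \<open>Source of the factor 1 / n. Since \<kappa> is at most 1, the density exp(-s) may be
  replaced by exp(-\<kappa> s), which is a constant multiple of the derivative of the base of the
  power; the integrand then is an exact derivative of a multiple of the \<open>n\<close>-th
  power.\<close>

lemma nn_integral_exp1_chord_power_le:
  assumes "0 < \<kappa>" "\<kappa> \<le> 1" "1 \<le> n"
  shows "(\<integral>\<^sup>+s. ennreal ((1 - 2 / pi * (1 - exp (- (\<kappa> * s)))) ^ (n - 1)) \<partial>exp1) \<le> ennreal (pi / (2 * \<kappa> * real n))"
proof -
  let ?\<phi> = "\<lambda>s. 1 - 2 / pi * (1 - exp (- (\<kappa> * s)))"
  have \<phi>_nonneg: "0 \<le> ?\<phi> s" for s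
  proof -
    have "2 / pi * (1 - exp (- (\<kappa> * s))) \<le> 2 / pi * 1" by (intro mult_left_mono) auto
    also have "\<dots> \<le> 1" using pi_gt3 by simp
    finally show ?thesis by simp
  qed
  have "(\<integral>\<^sup>+s. ennreal (?\<phi> s ^ (n - 1)) \<partial>exp1)
      \<le> (\<integral>\<^sup>+s. ennreal (exp (- (\<kappa> * s)) * ?\<phi> s ^ (n - 1)) * indicator {0..} s \<partial>lborel)"
  proof (subst nn_integral_exp1, simp, intro nn_integral_mono)
    fix s :: real
    have "exp (- s) * ?\<phi> s ^ (n - 1) \<le> exp (- (\<kappa> * s)) * ?\<phi> s ^ (n - 1)" if "0 \<le> s"
      using \<phi>_nonneg[of s] mult_right_mono[OF assms(2) that] by (intro mult_right_mono) auto
    then show "ennreal (exp (- s)) * ennreal (?\<phi> s ^ (n - 1)) * indicator {0..} s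
        \<le> ennreal (exp (- (\<kappa> * s)) * ?\<phi> s ^ (n - 1)) * indicator {0..} s"
      using \<phi>_nonneg[of s] by (auto simp flip: ennreal_mult intro!: ennreal_leI split: split_indicator)
  qed
  \<comment> \<open>The base decreases from 1 at s = 0 to 1 - 2 / pi at infinity. The contribution
    at infinity is nonpositive and is discarded next.\<close>
  also have "\<dots> = ennreal (- (pi / (2 * \<kappa> * real n)) * (1 - 2 / pi * (1 - 0)) ^ n
      - (- (pi / (2 * \<kappa> * real n)) * ?\<phi> 0 ^ n))"
  proof (rule nn_integral_FTC_atLeast[where F = "\<lambda>s. - (pi / (2 * \<kappa> * real n)) * ?\<phi> s ^ n"])
    fix s :: real
    show "((\<lambda>s. - (pi / (2 * \<kappa> * real n)) * ?\<phi> s ^ n) has_real_derivative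
        exp (- (\<kappa> * s)) * ?\<phi> s ^ (n - 1)) (at s)"
      using assms by (auto intro!: derivative_eq_intros)
    show "0 \<le> exp (- (\<kappa> * s)) * ?\<phi> s ^ (n - 1)" using \<phi>_nonneg[of s] by simp
  next
    have "((\<lambda>s. exp (- (\<kappa> * s))) \<longlongrightarrow> 0) at_top" using assms by real_asymp
    then show "((\<lambda>s. - (pi / (2 * \<kappa> * real n)) * ?\<phi> s ^ n) \<longlongrightarrow>
        - (pi / (2 * \<kappa> * real n)) * (1 - 2 / pi * (1 - 0)) ^ n) at_top"
      by (intro tendsto_intros)
  qed simp
  also have "\<dots> \<le> ennreal (pi / (2 * \<kappa> * real n))"
  proof (intro ennreal_leI)
    have "0 \<le> pi / (2 * \<kappa> * real n) * (1 - 2 / pi * (1 - 0)) ^ n"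
      using assms pi_gt3 by (intro mult_nonneg_nonneg zero_le_power) auto
    then show "- (pi / (2 * \<kappa> * real n)) * (1 - 2 / pi * (1 - 0)) ^ n
      - (- (pi / (2 * \<kappa> * real n)) * ?\<phi> 0 ^ n) \<le> pi / (2 * \<kappa> * real n)" by simp
  qed
  finally show ?thesis .
qed

text \<open>For fixed s, the weights read the profiles of D and of relay \<open>j\<close>, while the
  exponential factors read those of the other n - 1 relays. Exchanging the integrals puts s outside,
  and the inner expectation factorises over the nodes.\<close>

lemma nn_integral_weights_relay_first_le:
  assumes \<kappa>: "0 < \<kappa>" "\<kappa> \<le> 1" and j: "j \<in> {1..n}"
  shows "(\<integral>\<^sup>+p. dst_weight (p Dst) * relay_weight (p (Rel j)) * (\<integral>\<^sup>+e. relay_first n \<kappa> p e j \<partial>clocks n)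
       \<partial>(profiles n :: (node \<Rightarrow> 'd::finite profile) measure))
    \<le> (\<integral>\<^sup>+p. dst_weight p \<partial>(profile_dist :: 'd profile measure))
      * (\<integral>\<^sup>+p. relay_weight p \<partial>(profile_dist :: 'd profile measure)) * ennreal (pi / (2 * \<kappa> * real n))"
    (is "_ \<le> ?G * ?H * _")
proof -
  let ?P = "profiles n :: (node \<Rightarrow> 'd profile) measure"
  interpret P: prob_space "profiles n :: (node \<Rightarrow> 'd::finite profile) measure" by (rule prob_space_profiles)
  interpret E: prob_space exp1 by (rule prob_space_exp1)
  interpret PE: pair_sigma_finite "profiles n :: (node \<Rightarrow> 'd::finite profile) measure" exp1 ..
  let ?I = "{1..n} - {j}"
  let ?f = "\<lambda>s X. if X = Dst then dst_weight else if X = Rel j then relay_weight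
      else (\<lambda>q :: 'd profile. ennreal (exp (- (fst q * (\<kappa> * s)))))"
  have J: "insert Dst (insert (Rel j) (Rel ` ?I)) = nodes_with_profile n"
    using j by (auto simp: nodes_with_profile_def)
  have split: "(\<Prod>X\<in>nodes_with_profile n. g X) = g Dst * (g (Rel j) * (\<Prod>i\<in>?I. g (Rel i)))" for g :: "node \<Rightarrow> ennreal"
    unfolding J[symmetric]
    by (subst prod.insert, simp, force, subst prod.insert, simp, force, subst prod.reindex) (auto simp: inj_on_def)
  have prod_f: "(\<Prod>X\<in>nodes_with_profile n. ?f s X (p X))
     = dst_weight (p Dst) * relay_weight (p (Rel j)) * (\<Prod>i\<in>?I. ennreal (exp (- (fst (p (Rel i)) * (\<kappa> * s)))))" for s p
    unfolding split by (auto simp: mult.assoc intro!: arg_cong2[where f = "(*)"] prod.cong)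
  have meas_exp: "(\<lambda>s. \<Prod>i\<in>?I. ennreal (exp (- (c i * (\<kappa> * s))))) \<in> borel_measurable borel" for c :: "nat \<Rightarrow> real"
    by measurable
  have [measurable]: "Dst \<in> nodes_with_profile n" "Rel j \<in> nodes_with_profile n" using j by auto
  have meas: "(\<lambda>(p, s). \<Prod>X\<in>nodes_with_profile n. ?f s X (p X)) \<in> borel_measurable (?P \<Otimes>\<^sub>M exp1)"
    unfolding split_beta'
  proof (intro borel_measurable_prod_ennreal)
    fix X assume X [measurable]: "X \<in> nodes_with_profile n"
    show "(\<lambda>z. ?f (snd z) X (fst z X)) \<in> borel_measurable (?P \<Otimes>\<^sub>M exp1)"
      by (cases "X = Dst"; cases "X = Rel j") (simp_all, measurable)
  qed
  have "(\<integral>\<^sup>+p. dst_weight (p Dst) * relay_weight (p (Rel j)) * (\<integral>\<^sup>+e. relay_first n \<kappa> p e j \<partial>clocks n) \<partial>?P)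
    \<le> (\<integral>\<^sup>+p. dst_weight (p Dst) * relay_weight (p (Rel j)) *
        (\<integral>\<^sup>+s. (\<Prod>i\<in>?I. ennreal (exp (- (fst (p (Rel i)) * (\<kappa> * s))))) \<partial>exp1) \<partial>?P)"
    using j by (intro nn_integral_mono mult_left_mono nn_integral_relay_first_le) auto
  also have "\<dots> = (\<integral>\<^sup>+p. \<integral>\<^sup>+s. (\<Prod>X\<in>nodes_with_profile n. ?f s X (p X)) \<partial>exp1 \<partial>?P)"
    unfolding prod_f by (intro nn_integral_cong nn_integral_cmult[symmetric]) (simp add: meas_exp)
  also have "\<dots> = (\<integral>\<^sup>+s. \<integral>\<^sup>+p. (\<Prod>X\<in>nodes_with_profile n. ?f s X (p X)) \<partial>?P \<partial>exp1)"
    by (rule PE.Fubini'[OF meas, symmetric])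
  also have "\<dots> = (\<integral>\<^sup>+s. (\<Prod>X\<in>nodes_with_profile n. \<integral>\<^sup>+q. ?f s X q \<partial>(profile_dist :: 'd profile measure)) \<partial>exp1)"
    by (intro nn_integral_cong nn_integral_PiM_prod_inj[where h = "\<lambda>X. X"] prob_space_profile_dist) auto
  also have "\<dots> = (\<integral>\<^sup>+s. ?G * ?H * (\<integral>\<^sup>+q. ennreal (exp (- (fst q * (\<kappa> * s)))) \<partial>(profile_dist :: 'd profile measure)) ^ (n - 1) \<partial>exp1)"
  proof (intro nn_integral_cong)
    fix s
    have "(\<Prod>i\<in>?I. \<integral>\<^sup>+q. ?f s (Rel i) q \<partial>(profile_dist :: 'd profile measure))
      = (\<Prod>i\<in>?I. \<integral>\<^sup>+q. ennreal (exp (- (fst q * (\<kappa> * s)))) \<partial>(profile_dist :: 'd profile measure))"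
      by (intro prod.cong) auto
    then show "(\<Prod>X\<in>nodes_with_profile n. \<integral>\<^sup>+q. ?f s X q \<partial>(profile_dist :: 'd profile measure))
      = ?G * ?H * (\<integral>\<^sup>+q. ennreal (exp (- (fst q * (\<kappa> * s)))) \<partial>(profile_dist :: 'd profile measure)) ^ (n - 1)"
      unfolding split using j by (simp add: mult.assoc)
  qed
  also have "\<dots> \<le> (\<integral>\<^sup>+s. ?G * ?H * ennreal ((1 - 2 / pi * (1 - exp (- (\<kappa> * s)))) ^ (n - 1)) \<partial>exp1)"
  proof (rule nn_integral_mono_AE, use AE_exp1_nonneg in eventually_elim)
    case (elim s)
    have "2 / pi * (1 - exp (- (\<kappa> * s))) \<le> 2 / pi * 1" by (intro mult_left_mono) auto
    also have "\<dots> \<le> 1" using pi_gt3 by simp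
    finally have "0 \<le> 1 - 2 / pi * (1 - exp (- (\<kappa> * s)))" by simp
    moreover have "0 \<le> \<kappa> * s" using elim \<kappa> by simp
    ultimately show ?case
      by (simp only: ennreal_power[symmetric]) (intro mult_left_mono power_mono nn_integral_exp_fst_le, auto)
  qed
  also have "\<dots> = ?G * ?H * (\<integral>\<^sup>+s. ennreal ((1 - 2 / pi * (1 - exp (- (\<kappa> * s)))) ^ (n - 1)) \<partial>exp1)"
    by (rule nn_integral_cmult) simp
  also have "\<dots> \<le> ?G * ?H * ennreal (pi / (2 * \<kappa> * real n))"
    using \<kappa> j by (intro mult_left_mono nn_integral_exp1_chord_power_le) auto
  finally show ?thesis .
qed

text \<open>Both \<open>relay_first\<close> and \<open>poisson_clock\<close> read only clocks of
  pairs (S, relay). The clock of (\<open>A\<close>, D) can therefore be redrawn, and its residual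
  has mean at most 1 at whatever nonnegative time the other clocks determine.\<close>

lemma nn_integral_first_residual_le:
  fixes p :: "node \<Rightarrow> 'd::finite profile"
  assumes j: "j \<in> {1..n}" and A: "A \<in> {Src, Rel j}" and p: "p \<in> space (profiles n)"
  shows "(\<integral>\<^sup>+e. relay_first n \<kappa> p e j * residual (poisson_clock k \<delta> p e A j) (e {A, Dst}) \<partial>clocks n)
     \<le> (\<integral>\<^sup>+e. relay_first n \<kappa> p e j \<partial>clocks n)"
proof -
  have [measurable]: "(\<lambda>_. p) \<in> clocks n \<rightarrow>\<^sub>M profiles n" using p by simp
  have AD [measurable]: "{A, Dst} \<in> node_pairs n" "A \<in> all_nodes n" using j A by auto
  note [measurable] = j
  have "(\<integral>\<^sup>+e. relay_first n \<kappa> p e j * residual (poisson_clock k \<delta> p e A j) (e {A, Dst}) \<partial>clocks n)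
    = (\<integral>\<^sup>+e. \<integral>\<^sup>+y. relay_first n \<kappa> p (e({A, Dst} := y)) j *
        residual (poisson_clock k \<delta> p (e({A, Dst} := y)) A j) ((e({A, Dst} := y)) {A, Dst}) \<partial>unit_poisson \<partial>clocks n)"
    by (rule nn_integral_PiM_resample[OF prob_space_unit_poisson finite_node_pairs AD(1)]) measurable
  also have "\<dots> = (\<integral>\<^sup>+e. \<integral>\<^sup>+y. relay_first n \<kappa> p e j * residual (poisson_clock k \<delta> p e A j) y \<partial>unit_poisson \<partial>clocks n)"
    by (intro nn_integral_cong) (simp add: relay_first_def poisson_clock_def doubleton_eq_iff)
  also have "\<dots> = (\<integral>\<^sup>+e. relay_first n \<kappa> p e j * (\<integral>\<^sup>+y. residual (poisson_clock k \<delta> p e A j) y \<partial>unit_poisson) \<partial>clocks n)"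
    by (intro nn_integral_cong nn_integral_cmult) measurable
  also have "\<dots> \<le> (\<integral>\<^sup>+e. relay_first n \<kappa> p e j * 1 \<partial>clocks n)"
    by (intro nn_integral_mono mult_left_mono nn_integral_residual_le) (auto simp: poisson_clock_def)
  finally show ?thesis by simp
qed

lemma nn_integral_first_contacts:
  assumes "2 \<le> n"
  shows "(\<integral>\<^sup>+p. \<integral>\<^sup>+e. c * (ennreal (1 / sqrt (fst (p (Rel 1)))) * ennreal (1 / sqrt (fst (p (Rel 2)))))
       * (ennreal (e {Src, Rel 1} 0) + ennreal (e {Src, Rel 2} 0)) \<partial>clocks n
       \<partial>(profiles n :: (node \<Rightarrow> 'd::finite profile) measure))
    = c * (\<integral>\<^sup>+p. ennreal (1 / sqrt (fst p)) \<partial>(profile_dist :: 'd profile measure))\<^sup>2 * 2"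
proof -
  have n: "1 \<in> {1..n}" "2 \<in> {1..n}" using assms by auto
  have [measurable]: "{Src, Rel 1} \<in> node_pairs n" "{Src, Rel 2} \<in> node_pairs n"
    "Rel 1 \<in> nodes_with_profile n" "Rel 2 \<in> nodes_with_profile n"
    using n by (simp_all del: One_nat_def)
  have first: "(\<integral>\<^sup>+e. ennreal (e q 0) \<partial>clocks n) = 1" if [measurable]: "q \<in> node_pairs n" for q
  proof -
    have "(\<integral>\<^sup>+e. ennreal (e q 0) \<partial>clocks n) = (\<integral>\<^sup>+x. ennreal (x 0) \<partial>unit_poisson)"
      using nn_integral_PiM_prod_inj[OF prob_space_unit_poisson finite_node_pairs,
          of "\<lambda>q. q" "{q}" n "\<lambda>_ x. ennreal (x 0)"] that by simp
    also have "\<dots> = 1" by (simp add: nn_integral_unit_poisson_0 nn_integral_exp1_ident)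
    finally show ?thesis .
  qed
  have two: "(\<integral>\<^sup>+e. ennreal (e {Src, Rel 1} 0) + ennreal (e {Src, Rel 2} 0) \<partial>clocks n) = 2"
    using n by (subst nn_integral_add) (measurable, simp only: first node_pairs_intros one_add_one)
  have "(\<integral>\<^sup>+p. \<integral>\<^sup>+e. c * (ennreal (1 / sqrt (fst (p (Rel 1)))) * ennreal (1 / sqrt (fst (p (Rel 2)))))
       * (ennreal (e {Src, Rel 1} 0) + ennreal (e {Src, Rel 2} 0)) \<partial>clocks n
       \<partial>(profiles n :: (node \<Rightarrow> 'd::finite profile) measure))
    = (\<integral>\<^sup>+p. c * (ennreal (1 / sqrt (fst (p (Rel 1)))) * ennreal (1 / sqrt (fst (p (Rel 2))))) * 2
       \<partial>(profiles n :: (node \<Rightarrow> 'd::finite profile) measure))"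
  proof (intro nn_integral_cong)
    fix p :: "node \<Rightarrow> 'd profile"
    show "(\<integral>\<^sup>+e. c * (ennreal (1 / sqrt (fst (p (Rel 1)))) * ennreal (1 / sqrt (fst (p (Rel 2)))))
        * (ennreal (e {Src, Rel 1} 0) + ennreal (e {Src, Rel 2} 0)) \<partial>clocks n)
      = c * (ennreal (1 / sqrt (fst (p (Rel 1)))) * ennreal (1 / sqrt (fst (p (Rel 2))))) * 2"
      by (subst nn_integral_cmult) (measurable, simp only: two)
  qed
  also have "\<dots> = c * (\<integral>\<^sup>+p. ennreal (1 / sqrt (fst (p (Rel 1)))) * ennreal (1 / sqrt (fst (p (Rel 2))))
       \<partial>(profiles n :: (node \<Rightarrow> 'd::finite profile) measure)) * 2"
    by (subst nn_integral_multc, measurable, subst nn_integral_cmult, measurable)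
  also have "(\<integral>\<^sup>+p. ennreal (1 / sqrt (fst (p (Rel 1)))) * ennreal (1 / sqrt (fst (p (Rel 2))))
       \<partial>(profiles n :: (node \<Rightarrow> 'd::finite profile) measure))
     = (\<integral>\<^sup>+p. ennreal (1 / sqrt (fst p)) \<partial>(profile_dist :: 'd profile measure))\<^sup>2"
    using nn_integral_PiM_prod_inj[OF prob_space_profile_dist finite_nodes_with_profile,
        of "\<lambda>X. X" "{Rel 1, Rel 2}" n "\<lambda>_ q :: 'd profile. ennreal (1 / sqrt (fst q))"] n
    by (simp add: power2_eq_square)
  finally show ?thesis .
qed

lemma nn_integral_relay_term_le:
  assumes \<kappa>: "0 < \<kappa>" "\<kappa> \<le> 1" and j: "j \<in> {1..n}"
  shows "(\<integral>\<^sup>+p. \<integral>\<^sup>+e. c * dst_weight (p Dst) * relay_weight (p (Rel j)) *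
         (relay_first n \<kappa> p e j * (residual (poisson_clock k \<delta> p e Src j) (e {Src, Dst})
            + residual (poisson_clock k \<delta> p e (Rel j) j) (e {Rel j, Dst}))) \<partial>clocks n
       \<partial>(profiles n :: (node \<Rightarrow> 'd::finite profile) measure))
    \<le> c * ((\<integral>\<^sup>+p. dst_weight p \<partial>(profile_dist :: 'd profile measure))
      * (\<integral>\<^sup>+p. relay_weight p \<partial>(profile_dist :: 'd profile measure)) * ennreal (pi / (2 * \<kappa> * real n))) * 2"
proof -
  let ?P = "profiles n :: (node \<Rightarrow> 'd profile) measure"
  interpret C: prob_space "clocks n" by (rule prob_space_clocks)
  have [measurable]: "Dst \<in> nodes_with_profile n" "Rel j \<in> nodes_with_profile n"
    "{Src, Dst} \<in> node_pairs n" "{Rel j, Dst} \<in> node_pairs n" "Src \<in> all_nodes n" "Rel j \<in> all_nodes n"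
    "j \<in> {1..n}"
    using j by auto
  have "(\<integral>\<^sup>+p. \<integral>\<^sup>+e. c * dst_weight (p Dst) * relay_weight (p (Rel j)) *
         (relay_first n \<kappa> p e j * (residual (poisson_clock k \<delta> p e Src j) (e {Src, Dst})
            + residual (poisson_clock k \<delta> p e (Rel j) j) (e {Rel j, Dst}))) \<partial>clocks n \<partial>?P)
     \<le> (\<integral>\<^sup>+p. c * (dst_weight (p Dst) * relay_weight (p (Rel j)) *
         (\<integral>\<^sup>+e. relay_first n \<kappa> p e j \<partial>clocks n)) * 2 \<partial>?P)"
  proof (intro nn_integral_mono)
    fix p :: "node \<Rightarrow> 'd profile" assume p: "p \<in> space ?P"
    have [measurable]: "(\<lambda>_. p) \<in> clocks n \<rightarrow>\<^sub>M ?P" using p by simp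
    let ?r = "\<lambda>A e. relay_first n \<kappa> p e j * residual (poisson_clock k \<delta> p e A j) (e {A, Dst})"
    let ?c = "c * dst_weight (p Dst) * relay_weight (p (Rel j))"
    have "(\<integral>\<^sup>+e. ?c * (relay_first n \<kappa> p e j * (residual (poisson_clock k \<delta> p e Src j) (e {Src, Dst})
            + residual (poisson_clock k \<delta> p e (Rel j) j) (e {Rel j, Dst}))) \<partial>clocks n)
      = ?c * (\<integral>\<^sup>+e. relay_first n \<kappa> p e j * (residual (poisson_clock k \<delta> p e Src j) (e {Src, Dst})
            + residual (poisson_clock k \<delta> p e (Rel j) j) (e {Rel j, Dst})) \<partial>clocks n)"
      by (rule nn_integral_cmult) measurable
    also have "(\<integral>\<^sup>+e. relay_first n \<kappa> p e j * (residual (poisson_clock k \<delta> p e Src j) (e {Src, Dst})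
            + residual (poisson_clock k \<delta> p e (Rel j) j) (e {Rel j, Dst})) \<partial>clocks n)
      = (\<integral>\<^sup>+e. ?r Src e \<partial>clocks n) + (\<integral>\<^sup>+e. ?r (Rel j) e \<partial>clocks n)"
      unfolding distrib_left by (rule nn_integral_add) measurable
    also have "?c * \<dots> \<le> ?c * ((\<integral>\<^sup>+e. relay_first n \<kappa> p e j \<partial>clocks n) + (\<integral>\<^sup>+e. relay_first n \<kappa> p e j \<partial>clocks n))"
      using p j by (intro mult_left_mono add_mono nn_integral_first_residual_le) auto
    finally show "(\<integral>\<^sup>+e. ?c * (relay_first n \<kappa> p e j * (residual (poisson_clock k \<delta> p e Src j) (e {Src, Dst})
            + residual (poisson_clock k \<delta> p e (Rel j) j) (e {Rel j, Dst}))) \<partial>clocks n)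
      \<le> c * (dst_weight (p Dst) * relay_weight (p (Rel j)) * (\<integral>\<^sup>+e. relay_first n \<kappa> p e j \<partial>clocks n)) * 2"
      by (simp add: mult_2_right[symmetric] mult.assoc)
  qed
  also have "\<dots> = c * (\<integral>\<^sup>+p. dst_weight (p Dst) * relay_weight (p (Rel j)) *
         (\<integral>\<^sup>+e. relay_first n \<kappa> p e j \<partial>clocks n) \<partial>?P) * 2"
    by (subst nn_integral_multc, measurable, subst nn_integral_cmult, measurable)
  also have "\<dots> \<le> c * ((\<integral>\<^sup>+p. dst_weight p \<partial>(profile_dist :: 'd profile measure))
      * (\<integral>\<^sup>+p. relay_weight p \<partial>(profile_dist :: 'd profile measure)) * ennreal (pi / (2 * \<kappa> * real n))) * 2"
    using nn_integral_weights_relay_first_le[OF \<kappa> j, where 'd = 'd]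
    by (intro mult_right_mono mult_left_mono) auto
  finally show ?thesis .
qed

text \<open>The condition \<open>\<delta> \<le> k\<close> makes \<kappa> at least 1/2. Summing over
  the n relays cancels the 1 / n of each term, and the two residuals contribute a factor 2, which
  leaves pi / \<kappa>, at most 2 pi.\<close>

lemma expected_delivery_time_le:
  fixes k \<delta> :: real
  assumes n: "2 \<le> n" and k: "0 < k" and \<delta>: "0 < \<delta>" "\<delta> \<le> k"
  shows "(\<integral>\<^sup>+ \<omega>. ennreal (fm_delivery_time n k \<delta> \<omega>)
      \<partial>(net_space n :: ((node \<Rightarrow> 'd::finite profile) \<times> (node set \<Rightarrow> nat \<Rightarrow> real)) measure))
    \<le> ennreal (1 / k) * (\<integral>\<^sup>+p. ennreal (1 / sqrt (fst p)) \<partial>(profile_dist :: 'd profile measure))\<^sup>2 * 2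
      + ennreal (1 / k) * ((\<integral>\<^sup>+p. dst_weight p \<partial>(profile_dist :: 'd profile measure))
         * (\<integral>\<^sup>+p. relay_weight p \<partial>(profile_dist :: 'd profile measure))) * ennreal (2 * pi)"
proof -
  let ?P = "profiles n :: (node \<Rightarrow> 'd profile) measure"
  define \<kappa> where "\<kappa> = k / (k + \<delta>)"
  have \<kappa>: "0 < \<kappa>" "\<kappa> \<le> 1" "1 / 2 \<le> \<kappa>" using k \<delta> by (simp_all add: \<kappa>_def field_simps)
  interpret P: prob_space ?P by (rule prob_space_profiles)
  interpret C: prob_space "clocks n" by (rule prob_space_clocks)
  define G where "G = (\<integral>\<^sup>+p. dst_weight p \<partial>(profile_dist :: 'd profile measure))"
  define H where "H = (\<integral>\<^sup>+p. relay_weight p \<partial>(profile_dist :: 'd profile measure))"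
  define c where "c = ennreal (1 / k)"
  define A where "A p e = c * (ennreal (1 / sqrt (fst (p (Rel 1)))) * ennreal (1 / sqrt (fst (p (Rel 2)))))
       * (ennreal (e {Src, Rel 1} 0) + ennreal (e {Src, Rel 2} 0))"
    for p :: "node \<Rightarrow> 'd profile" and e :: "node set \<Rightarrow> nat \<Rightarrow> real"
  define B where "B j p e = c * dst_weight (p Dst) * relay_weight (p (Rel j)) *
         (relay_first n \<kappa> p e j * (residual (poisson_clock k \<delta> p e Src j) (e {Src, Dst})
            + residual (poisson_clock k \<delta> p e (Rel j) j) (e {Rel j, Dst})))"
    for j and p :: "node \<Rightarrow> 'd profile" and e :: "node set \<Rightarrow> nat \<Rightarrow> real"
  have [measurable]: "(\<lambda>z. A (fst z) (snd z)) \<in> borel_measurable (?P \<Otimes>\<^sub>M clocks n)"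
  proof -
    have "1 \<in> {1..n}" "2 \<in> {1..n}" using n by auto
    then have [measurable]: "{Src, Rel 1} \<in> node_pairs n" "{Src, Rel 2} \<in> node_pairs n"
      "Rel 1 \<in> nodes_with_profile n" "Rel 2 \<in> nodes_with_profile n"
      by (simp_all del: One_nat_def)
    show ?thesis unfolding A_def by measurable
  qed
  have B_meas [measurable]: "(\<lambda>z. B j (fst z) (snd z)) \<in> borel_measurable (?P \<Otimes>\<^sub>M clocks n)"
    if j [measurable]: "j \<in> {1..n}" for j
  proof -
    have [measurable]: "Dst \<in> nodes_with_profile n" "Rel j \<in> nodes_with_profile n"
      "{Src, Dst} \<in> node_pairs n" "{Rel j, Dst} \<in> node_pairs n" "Src \<in> all_nodes n" "Rel j \<in> all_nodes n"
      using j by auto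
    show ?thesis unfolding B_def by measurable
  qed
  have good_p: "AE p in ?P. \<forall>X\<in>nodes_with_profile n. interior_profile (p X)"
    by (intro AE_finite_allI AE_PiM_component prob_space_profile_dist AE_interior_profile) auto
  have good_e: "AE e in clocks n. \<forall>q\<in>node_pairs n. 0 \<le> e q 0 \<and> (\<forall>t. \<exists>i. t < arrival (e q) i)"
  proof (intro AE_finite_allI AE_PiM_component prob_space_unit_poisson)
    show "AE x in unit_poisson. 0 \<le> x 0 \<and> (\<forall>t. \<exists>i. t < arrival x i)"
      using AE_unit_poisson_first_nonneg AE_unit_poisson_unbounded by eventually_elim simp
  qed auto
  have "(\<integral>\<^sup>+ \<omega>. ennreal (fm_delivery_time n k \<delta> \<omega>) \<partial>(net_space n :: ((node \<Rightarrow> 'd profile) \<times> _) measure))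
    \<le> (\<integral>\<^sup>+ \<omega>. A (fst \<omega>) (snd \<omega>) + (\<Sum>j\<in>{1..n}. B j (fst \<omega>) (snd \<omega>)) \<partial>(?P \<Otimes>\<^sub>M clocks n))"
    unfolding net_space_def
  proof (rule nn_integral_mono_AE)
    show "AE \<omega> in ?P \<Otimes>\<^sub>M clocks n. ennreal (fm_delivery_time n k \<delta> \<omega>)
        \<le> A (fst \<omega>) (snd \<omega>) + (\<Sum>j\<in>{1..n}. B j (fst \<omega>) (snd \<omega>))"
      using AE_pair_fst[OF C.sigma_finite_measure_axioms good_p]
        AE_pair_snd[OF C.sigma_finite_measure_axioms good_e]
    proof eventually_elim
      case (elim \<omega>)
      show ?case
        using fm_delivery_time_le[OF n k \<delta>(1) \<kappa>_def, of "fst \<omega>" "snd \<omega>"] elim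
        by (simp add: A_def B_def c_def)
    qed
  qed
  also have "\<dots> = (\<integral>\<^sup>+ \<omega>. A (fst \<omega>) (snd \<omega>) \<partial>(?P \<Otimes>\<^sub>M clocks n))
      + (\<Sum>j\<in>{1..n}. \<integral>\<^sup>+ \<omega>. B j (fst \<omega>) (snd \<omega>) \<partial>(?P \<Otimes>\<^sub>M clocks n))"
    by (subst nn_integral_add, measurable, subst nn_integral_sum) (auto intro: B_meas)
  also have "\<dots> = (\<integral>\<^sup>+p. \<integral>\<^sup>+e. A p e \<partial>clocks n \<partial>?P) + (\<Sum>j\<in>{1..n}. \<integral>\<^sup>+p. \<integral>\<^sup>+e. B j p e \<partial>clocks n \<partial>?P)"
    by (simp add: C.nn_integral_fst[symmetric])
  also have "\<dots> \<le> c * (\<integral>\<^sup>+p. ennreal (1 / sqrt (fst p)) \<partial>(profile_dist :: 'd profile measure))\<^sup>2 * 2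
      + (\<Sum>j\<in>{1..n}. c * (G * H * ennreal (pi / (2 * \<kappa> * real n))) * 2)"
    unfolding A_def B_def G_def H_def
    by (intro add_mono sum_mono nn_integral_relay_term_le \<kappa> eq_refl nn_integral_first_contacts n)
  also have "(\<Sum>j\<in>{1..n}. c * (G * H * ennreal (pi / (2 * \<kappa> * real n))) * 2)
      = c * (G * H) * (ennreal (pi / (2 * \<kappa> * real n)) * ennreal (2 * real n))"
    by (simp add: ennreal_mult ennreal_of_nat_eq_real_of_nat mult_ac)
  also have "ennreal (pi / (2 * \<kappa> * real n)) * ennreal (2 * real n) = ennreal (pi / \<kappa>)"
    using \<kappa> n by (simp flip: ennreal_mult)
  also have "\<dots> \<le> ennreal (2 * pi)"
    using \<kappa> by (intro ennreal_leI) (simp add: field_simps)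
  finally show ?thesis
    unfolding c_def G_def H_def by (simp add: add_left_mono mult_left_mono)
qed

theorem theorem6:
  fixes lam :: real and \<delta> :: "nat \<Rightarrow> real"
  assumes "lam > 0" and "\<And>n. \<delta> n > 0" and "\<delta> \<longlonglongrightarrow> 0"
  shows "\<exists>C::real. \<forall>\<^sub>F n in sequentially.
           (\<integral>\<^sup>+ \<omega>. ennreal (fm_delivery_time n (pi / 2 * (lam - \<delta> n)) (\<delta> n) \<omega>)
              \<partial>(net_space n :: ((node \<Rightarrow> 'd::finite profile) \<times> (node set \<Rightarrow> nat \<Rightarrow> real)) measure))
           \<le> ennreal C"
proof -
  define A where "A = (\<integral>\<^sup>+p. ennreal (1 / sqrt (fst p)) \<partial>(profile_dist :: 'd profile measure))"
  define G where "G = (\<integral>\<^sup>+p. dst_weight p \<partial>(profile_dist :: 'd profile measure))"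
  define H where "H = (\<integral>\<^sup>+p. relay_weight p \<partial>(profile_dist :: 'd profile measure))"
  have fin: "A < \<infinity>" "G < \<infinity>" "H < \<infinity>"
    using nn_integral_inverse_sqrt_fst_finite nn_integral_inverse_sqrt_fst_norm_snd_finite
      nn_integral_sum_inverse_sqrt_snd_finite
    by (simp_all add: A_def G_def H_def dst_weight_def relay_weight_def)
  \<comment> \<open>Once \<delta> n < lam / 2, the coefficient pi / 2 * (lam - \<delta> n) is at
    least this value, which no longer depends on n.\<close>
  define k0 where "k0 = pi * lam / 4"
  define C where "C = ennreal (1 / k0) * A\<^sup>2 * 2 + ennreal (1 / k0) * (G * H) * ennreal (2 * pi)"
  have "C < \<infinity>" using fin by (simp add: C_def ennreal_mult_less_top power2_eq_square)
  then have C: "C = ennreal (enn2real C)" by simp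
  have "\<forall>\<^sub>F n in sequentially. \<delta> n < lam / 2"
    using assms by (intro order_tendstoD(2)[OF assms(3)]) auto
  moreover have "\<forall>\<^sub>F n in sequentially. (2::nat) \<le> n" by (rule eventually_ge_at_top)
  ultimately have "\<forall>\<^sub>F n in sequentially.
           (\<integral>\<^sup>+ \<omega>. ennreal (fm_delivery_time n (pi / 2 * (lam - \<delta> n)) (\<delta> n) \<omega>)
              \<partial>(net_space n :: ((node \<Rightarrow> 'd profile) \<times> (node set \<Rightarrow> nat \<Rightarrow> real)) measure)) \<le> C"
  proof eventually_elim
    case (elim n)
    let ?k = "pi / 2 * (lam - \<delta> n)"
    have "pi / 2 * (lam / 2) \<le> ?k" using elim by (intro mult_left_mono) auto
    then have k0: "k0 \<le> ?k" by (simp add: k0_def)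
    have "0 < k0" using assms by (simp add: k0_def)
    have "\<delta> n \<le> lam / 2" using elim by simp
    \<comment> \<open>Here pi / 4 is at least 1/2, so the same range of n also yields
      \<open>\<delta> n \<le> ?k\<close>.\<close>
    also have "\<dots> \<le> k0" using assms(1) pi_gt3 by (simp add: k0_def field_simps)
    finally have "\<delta> n \<le> ?k" using k0 by simp
    then have "(\<integral>\<^sup>+ \<omega>. ennreal (fm_delivery_time n ?k (\<delta> n) \<omega>)
        \<partial>(net_space n :: ((node \<Rightarrow> 'd profile) \<times> (node set \<Rightarrow> nat \<Rightarrow> real)) measure))
      \<le> ennreal (1 / ?k) * A\<^sup>2 * 2 + ennreal (1 / ?k) * (G * H) * ennreal (2 * pi)"
      unfolding A_def G_def H_def using elim assms(2) \<open>0 < k0\<close> k0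
      by (intro expected_delivery_time_le) auto
    also have "\<dots> \<le> C"
      unfolding C_def using \<open>0 < k0\<close> k0
      by (intro add_mono mult_right_mono ennreal_leI divide_left_mono) auto
    finally show ?case .
  qed
  then show ?thesis by (intro exI[of _ "enn2real C"]) (simp only: C[symmetric])
qed

end
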